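(* Regarding $\sigma_\pm(z)$ and $\overline\sigma_\pm(z)$ as maps $F\to F[[z^{\pm1}]]$, the following commutation rules hold: $$\sigma_-(w)\sigma_+(z)=i_{w,z}\frac{w}{w-z}\cdot\sigma_+(z)\sigma_-(w),$$ $$\overline\sigma_-(z)\overline\sigma_+(w)=i_{z,w}\frac{z}{z-w}\cdot\overline\sigma_+(w)\overline\sigma_-(z).$$
   Context: Exterior algebra and Schubert derivations. $M=\bigoplus_{i\in\mathbb Z}\mathbb Z b_i$ is a free abelian group with basis $(b_i)_{i\in\mathbb Z}$, $\bigwedge M$ its exterior algebra over $\mathbb Z$. A Hasse–Schmidt (HS) derivation on $\bigwedge M$ is a $\mathbb Z$-linear map $\mathcal D(z):\bigwedge M\to\bigwedge M[[z]]$ (or $\bigwedge M[[z^{-1}]]$) with $\mathcal D(z)(u\wedge v)=\mathcal D(z)u\wedge\mathcal D(z)v$. The Schubert derivations $\sigma_\pm(z)=\sum_{i\ge0}\sigma_{\pm i}z^{\pm i}$ are the unique HS derivations with $\sigma_\pm(z)b_j=\sum_{i\ge0}b_{j\pm i}z^{\pm i}$; their formal inverses $\overline\sigma_\pm(z)=\sum_{i\ge0}(-1)^i\overline\sigma_{\pm i}z^{\pm i}$ are the unique HS derivations with $\overline\sigma_\pm(z)b_j=b_j-b_{j\pm1}z^{\pm1}$. Fermionic Fock space. $\mathcal P$ is the set of partitions, $\mathcal P_r$ those of length $\ell(\lambda)\le r$. For $\lambda\in\mathcal P_r$, $\mathbf b^r_{m+\lambda}:=b_{m+\lambda_1}\wedge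 b_{m-1+\lambda_2}\wedge\cdots\wedge b_{m-r+1+\lambda_r}$. Let $[M]$ be the free $\mathbb Z$-module with basis $([\mathbf b]_m)_{m\in\mathbb Z}$, and $F:=(\bigwedge M\otimes_{\mathbb Z}[M])/W$ where $W$ is the $\bigwedge M$-submodule generated by all $b_m\otimes[\mathbf b]_{m-1}-1\otimes[\mathbf b]_m$ and $b_m\otimes[\mathbf b]_m$, $m\in\mathbb Z$. The class of $u\otimes[\mathbf b]_m$ is written $u\wedge[\mathbf b]_m$. Put $[\mathbf b]_{m+\lambda}:=\mathbf b^r_{m+\lambda}\wedge[\mathbf b]_{m-r}$ for any $r\ge\ell(\lambda)$ (independent of $r$). Then $F=\bigoplus_m F_m$, $F_m=\bigoplus_{\lambda\in\mathcal P}\mathbb Z[\mathbf b]_{m+\lambda}$. Extension to $F$. Put $\sigma_+(z)[\mathbf b]_m=(\sigma_+(z)b_m)\wedge[\mathbf b]_{m-1}$, $\overline\sigma_+(z)[\mathbf b]_m=\sum_{j\ge0}(-1)^j[\mathbf b]_{m+(1^j)}z^j$, $\sigma_-(z)[\mathbf b]_m=\overline\sigma_-(z)[\mathbf b]_m=[\mathbf b]_m$, and for each $\tau(z)\in\{\sigma_\pm(z),\overline\sigma_\pm(z)\}$ put $\tau(z)[\mathbf b]_{m+\lambda}=\tau(z)\mathbf b^r_{m+\lambda}\wedge\tau(z)[\mathbf b]_{m-r}$ ($r\ge\ell(\lambda)$), extended $\mathbb Z$-linearly to $F$. Compositions are right to left, applied coefficientwise to formal series. $i_{w,z}$ denotes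 expansion of a rational expression as a power series in $z/w$, and $i_{z,w}$ expansion as a power series in $w/z$; thus $i_{w,z}\frac{w}{w-z}=\sum_{k\ge0}(z/w)^k$ and $i_{z,w}\frac{z}{z-w}=\sum_{k\ge0}(w/z)^k$. *)

theory Defs
  imports
    "HOL-Library.Poly_Mapping"
    "HOL-Computational_Algebra.Formal_Power_Series"
begin

section \<open>The exterior algebra of the free abelian group on \<open>(b\<^sub>i)\<^sub>i\<close>\<close>

text \<open>
  The tensor algebra of \<open>M = \<Oplus>\<^sub>i \<int> b\<^sub>i\<close> is the monoid ring over the integers of the free monoid on
  the indices. Poly_Mapping provides monoid rings for additively written, possibly
  noncommutative, monoids, so words are made an instance of \<open>monoid_add\<close> with concatenation
  as \<open>+\<close>.
\<close>

datatype index_word = Word (letters: "int list")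

instantiation index_word :: monoid_add
begin

definition zero_index_word :: index_word where "0 = Word []"

definition plus_index_word :: "index_word \<Rightarrow> index_word \<Rightarrow> index_word"
  where "v + w = Word (letters v @ letters w)"

instance
  by standard (simp_all add: zero_index_word_def plus_index_word_def)

end

type_synonym tensor = "index_word \<Rightarrow>\<^sub>0 int"

definition tensor_of :: "(int \<Rightarrow>\<^sub>0 int) \<Rightarrow> tensor"
  where "tensor_of v =
    (\<Sum>i\<in>Poly_Mapping.keys v. Poly_Mapping.single (Word [i]) (Poly_Mapping.lookup v i))"

inductive_set ext_ideal :: "tensor set" where
  zero: "0 \<in> ext_ideal"
| add: "x \<in> ext_ideal \<Longrightarrow> y \<in> ext_ideal \<Longrightarrow> x + y \<in> ext_ideal"
| square: "a * (tensor_of v * tensor_of v) * c \<in> ext_ideal"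

lemma ext_ideal_mult_left: "x \<in> ext_ideal \<Longrightarrow> a * x \<in> ext_ideal"
proof (induction rule: ext_ideal.induct)
  case (square c v d)
  have "a * (c * (tensor_of v * tensor_of v) * d) = (a * c) * (tensor_of v * tensor_of v) * d"
    by (simp add: mult.assoc)
  then show ?case by (metis ext_ideal.square)
qed (simp_all add: distrib_left ext_ideal.zero ext_ideal.add)

lemma ext_ideal_mult_right: "x \<in> ext_ideal \<Longrightarrow> x * a \<in> ext_ideal"
proof (induction rule: ext_ideal.induct)
  case (square c v d)
  have "(c * (tensor_of v * tensor_of v) * d) * a = c * (tensor_of v * tensor_of v) * (d * a)"
    by (simp add: mult.assoc)
  then show ?case by (metis ext_ideal.square)
qed (simp_all add: distrib_right ext_ideal.zero ext_ideal.add)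

lemma ext_ideal_uminus: "x \<in> ext_ideal \<Longrightarrow> - x \<in> ext_ideal"
  using ext_ideal_mult_left[of x "- 1"] by simp

lemma ext_ideal_diff: "x \<in> ext_ideal \<Longrightarrow> y \<in> ext_ideal \<Longrightarrow> x - y \<in> ext_ideal"
  using ext_ideal.add[of x "- y"] ext_ideal_uminus[of y] by simp

lemma index_word_sum_eq_0_iff: "0 = k + l \<longleftrightarrow> k = 0 \<and> l = (0 :: index_word)"
  by (cases k; cases l) (auto simp: zero_index_word_def plus_index_word_def)

lemma lookup_times_0:
  "Poly_Mapping.lookup (x * y :: tensor) 0 = Poly_Mapping.lookup x 0 * Poly_Mapping.lookup y 0"
proof -
  have "Poly_Mapping.lookup (x * y) 0 =
      Sum_any (\<lambda>k. Poly_Mapping.lookup x k * Sum_any (\<lambda>l. Poly_Mapping.lookup y l when 0 = k + l))"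
    by (simp add: times_poly_mapping.rep_eq prod_fun_def)
  also have "\<dots> = Sum_any (\<lambda>k :: index_word.
      Poly_Mapping.lookup x 0 * Poly_Mapping.lookup y 0 when k = 0)"
  proof (rule Sum_any.cong)
    fix k :: index_word
    have "Sum_any (\<lambda>l. Poly_Mapping.lookup y l when 0 = k + l) = (Poly_Mapping.lookup y 0 when k = 0)"
      by (cases "k = 0") (simp_all add: index_word_sum_eq_0_iff)
    then show "Poly_Mapping.lookup x k * Sum_any (\<lambda>l. Poly_Mapping.lookup y l when 0 = k + l) =
        (Poly_Mapping.lookup x 0 * Poly_Mapping.lookup y 0 when k = 0)"
      by (simp add: when_def)
  qed
  also have "\<dots> = Poly_Mapping.lookup x 0 * Poly_Mapping.lookup y 0"
    by simp
  finally show ?thesis .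
qed

lemma ext_ideal_lookup_0: "x \<in> ext_ideal \<Longrightarrow> Poly_Mapping.lookup x 0 = 0"
proof (induction rule: ext_ideal.induct)
  case (square a v c)
  have "Poly_Mapping.lookup (tensor_of v) 0 = 0"
    by (simp add: tensor_of_def lookup_sum lookup_single zero_index_word_def)
  then show ?case by (simp add: lookup_times_0)
qed (simp_all add: lookup_add)

quotient_type ext = tensor / "\<lambda>x y. x - y \<in> ext_ideal"
proof (rule equivpI)
  show "reflp (\<lambda>x y. x - y \<in> ext_ideal)"
    by (simp add: reflp_def ext_ideal.zero)
  show "symp (\<lambda>x y. x - y \<in> ext_ideal)"
    by (metis (no_types, lifting) sympI ext_ideal_uminus minus_diff_eq)
  show "transp (\<lambda>x y. x - y \<in> ext_ideal)"
  proof (rule transpI)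
    fix x y z assume "x - y \<in> ext_ideal" "y - z \<in> ext_ideal"
    then show "x - z \<in> ext_ideal"
      using ext_ideal.add[of "x - y" "y - z"] by simp
  qed
qed

instantiation ext :: ring_1
begin

lift_definition zero_ext :: ext is 0 .
lift_definition one_ext :: ext is 1 .

lift_definition plus_ext :: "ext \<Rightarrow> ext \<Rightarrow> ext" is "(+)"
  by (simp add: add_diff_add ext_ideal.add)

lift_definition uminus_ext :: "ext \<Rightarrow> ext" is uminus
  by (metis ext_ideal_uminus minus_diff_minus)

lift_definition minus_ext :: "ext \<Rightarrow> ext \<Rightarrow> ext" is "(-)"
proof -
  fix x x' y y' :: tensor
  assume "x - x' \<in> ext_ideal" "y - y' \<in> ext_ideal"
  then show "x - y - (x' - y') \<in> ext_ideal"
    using ext_ideal_diff[of "x - x'" "y - y'"] by (simp add: algebra_simps)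
qed

lift_definition times_ext :: "ext \<Rightarrow> ext \<Rightarrow> ext" is "(*)"
proof -
  fix x x' y y' :: tensor
  assume "x - x' \<in> ext_ideal" "y - y' \<in> ext_ideal"
  then have "(x - x') * y + x' * (y - y') \<in> ext_ideal"
    by (intro ext_ideal.add ext_ideal_mult_left ext_ideal_mult_right)
  then show "x * y - x' * y' \<in> ext_ideal"
    by (simp add: algebra_simps)
qed

instance
proof
  have "(0 :: tensor) - 1 \<notin> ext_ideal"
    using ext_ideal_lookup_0[of "0 - 1"] by (auto simp: lookup_minus lookup_one)
  then show "(0 :: ext) \<noteq> 1"
    by transfer
qed (transfer, simp add: algebra_simps ext_ideal.zero)+

end

lift_definition bM :: "int \<Rightarrow> ext" is "\<lambda>i. tensor_of (Poly_Mapping.single i 1)" .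

section \<open>Schubert derivations\<close>

text \<open>
  Series in \<open>z\<close> and series in \<open>z\<inverse>\<close> are both represented by the type \<open>fps\<close>; the formal variable
  of the values of \<open>sigma_minus\<close> and \<open>sigma_bar_minus\<close> is \<open>z\<inverse>\<close>. Linearity over the integers is
  additivity.
\<close>

definition HS_derivation :: "(ext \<Rightarrow> ext fps) \<Rightarrow> bool"
  where "HS_derivation D \<longleftrightarrow> additive D \<and> (\<forall>u v. D (u * v) = D u * D v)"

definition sigma_plus :: "ext \<Rightarrow> ext fps"
  where "sigma_plus =
    (THE D. HS_derivation D \<and> (\<forall>j. D (bM j) = Abs_fps (\<lambda>i. bM (j + int i))))"

definition sigma_minus :: "ext \<Rightarrow> ext fps"
  where "sigma_minus =
    (THE D. HS_derivation D \<and> (\<forall>j. D (bM j) = Abs_fps (\<lambda>i. bM (j - int i))))"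

definition sigma_bar_plus :: "ext \<Rightarrow> ext fps"
  where "sigma_bar_plus =
    (THE D. HS_derivation D \<and>
      (\<forall>j. D (bM j) = fps_const (bM j) - fps_const (bM (j + 1)) * fps_X))"

definition sigma_bar_minus :: "ext \<Rightarrow> ext fps"
  where "sigma_bar_minus =
    (THE D. HS_derivation D \<and>
      (\<forall>j. D (bM j) = fps_const (bM j) - fps_const (bM (j - 1)) * fps_X))"

section \<open>Fermionic Fock space\<close>

text \<open>
  As \<open>[M]\<close> is free on \<open>([b]\<^sub>m)\<^sub>m\<close>, the tensor product \<open>\<And>M \<otimes> [M]\<close> is the \<open>\<And>M\<close>-module of finitely
  supported functions from the integers to \<open>\<And>M\<close>, with \<open>u \<otimes> [b]\<^sub>m\<close> being \<open>single m u\<close>.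
\<close>

type_synonym pre_fock = "int \<Rightarrow>\<^sub>0 ext"

definition pre_act :: "ext \<Rightarrow> pre_fock \<Rightarrow> pre_fock"
  where "pre_act u x = Poly_Mapping.map ((*) u) x"

inductive_set fock_rel :: "pre_fock set" where
  zero: "0 \<in> fock_rel"
| add: "x \<in> fock_rel \<Longrightarrow> y \<in> fock_rel \<Longrightarrow> x + y \<in> fock_rel"
| absorb: "pre_act u (Poly_Mapping.single (m - 1) (bM m) - Poly_Mapping.single m 1) \<in> fock_rel"
| kill: "pre_act u (Poly_Mapping.single m (bM m)) \<in> fock_rel"

lemma lookup_pre_act: "Poly_Mapping.lookup (pre_act u x) m = u * Poly_Mapping.lookup x m"
  unfolding pre_act_def by transfer (simp add: when_def)

lemma pre_act_add: "pre_act u (x + y) = pre_act u x + pre_act u y"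
  by (rule poly_mapping_eqI) (simp add: lookup_pre_act lookup_add distrib_left)

lemma pre_act_diff: "pre_act u (x - y) = pre_act u x - pre_act u y"
  by (rule poly_mapping_eqI) (simp add: lookup_pre_act lookup_minus right_diff_distrib)

lemma pre_act_0: "pre_act u 0 = 0"
  by (rule poly_mapping_eqI) (simp add: lookup_pre_act)

lemma pre_act_uminus_1: "pre_act (- 1) x = - x"
  by (rule poly_mapping_eqI) (simp add: lookup_pre_act)

lemma pre_act_pre_act: "pre_act u (pre_act v x) = pre_act (u * v) x"
  by (rule poly_mapping_eqI) (simp add: lookup_pre_act mult.assoc)

lemma pre_act_fock_rel: "x \<in> fock_rel \<Longrightarrow> pre_act u x \<in> fock_rel"
  by (induction rule: fock_rel.induct)
    (auto simp: pre_act_0 pre_act_add pre_act_pre_act intro: fock_rel.intros)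

lemma fock_rel_uminus: "x \<in> fock_rel \<Longrightarrow> - x \<in> fock_rel"
  using pre_act_fock_rel[of x "- 1"] by (simp add: pre_act_uminus_1)

lemma fock_rel_diff: "x \<in> fock_rel \<Longrightarrow> y \<in> fock_rel \<Longrightarrow> x - y \<in> fock_rel"
  using fock_rel.add[of x "- y"] fock_rel_uminus[of y] by simp

quotient_type fock = pre_fock / "\<lambda>x y. x - y \<in> fock_rel"
proof (rule equivpI)
  show "reflp (\<lambda>x y. x - y \<in> fock_rel)"
    by (simp add: reflp_def fock_rel.zero)
  show "symp (\<lambda>x y. x - y \<in> fock_rel)"
    by (metis (no_types, lifting) sympI fock_rel_uminus minus_diff_eq)
  show "transp (\<lambda>x y. x - y \<in> fock_rel)"
  proof (rule transpI)
    fix x y z assume "x - y \<in> fock_rel" "y - z \<in> fock_rel"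
    then show "x - z \<in> fock_rel"
      using fock_rel.add[of "x - y" "y - z"] by simp
  qed
qed

instantiation fock :: ab_group_add
begin

lift_definition zero_fock :: fock is 0 .

lift_definition plus_fock :: "fock \<Rightarrow> fock \<Rightarrow> fock" is "(+)"
  by (simp add: add_diff_add fock_rel.add)

lift_definition uminus_fock :: "fock \<Rightarrow> fock" is uminus
  by (metis fock_rel_uminus minus_diff_minus)

lift_definition minus_fock :: "fock \<Rightarrow> fock \<Rightarrow> fock" is "(-)"
proof -
  fix x x' y y' :: pre_fock
  assume "x - x' \<in> fock_rel" "y - y' \<in> fock_rel"
  then show "x - y - (x' - y') \<in> fock_rel"
    using fock_rel_diff[of "x - x'" "y - y'"] by (simp add: algebra_simps)
qed

instance
  by standard (transfer, simp add: algebra_simps fock_rel.zero)+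

end

lift_definition wedge :: "ext \<Rightarrow> fock \<Rightarrow> fock" (infixr "\<diamondop>" 70) is pre_act
  by (metis pre_act_diff pre_act_fock_rel)

lift_definition vac :: "int \<Rightarrow> fock" is "\<lambda>m. Poly_Mapping.single m 1" .

definition int_scale :: "int \<Rightarrow> fock \<Rightarrow> fock"
  where "int_scale c x = of_int c \<diamondop> x"

text \<open>Partitions are weakly decreasing lists of positive parts, so \<open>\<ell>(\<lambda>)\<close> is \<open>length\<close>.\<close>

definition is_partition :: "nat list \<Rightarrow> bool"
  where "is_partition l \<longleftrightarrow> sorted_wrt (\<ge>) l \<and> 0 \<notin> set l"

text \<open>Indices are shifted: \<open>part l i\<close> is \<open>\<lambda>\<^sub>i\<^sub>+\<^sub>1\<close>.\<close>

definition part :: "nat list \<Rightarrow> nat \<Rightarrow> nat"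
  where "part l i = (if i < length l then l ! i else 0)"

definition b_row :: "nat \<Rightarrow> int \<Rightarrow> nat list \<Rightarrow> ext"
  where "b_row r m l = prod_list (map (\<lambda>i. bM (m - int i + int (part l i))) [0..<r])"

text \<open>\<open>[b]\<^sub>m\<^sub>+\<^sub>\<lambda>\<close> is defined with \<open>r = \<ell>(\<lambda>)\<close>; the next lemma shows that any larger \<open>r\<close> will do.\<close>

definition vac_part :: "int \<Rightarrow> nat list \<Rightarrow> fock"
  where "vac_part m l = b_row (length l) m l \<diamondop> vac (m - int (length l))"

lemma wedge_wedge: "u \<diamondop> v \<diamondop> x = (u * v) \<diamondop> x"
  by transfer (simp add: pre_act_pre_act fock_rel.zero)

lemma bM_wedge_vac: "bM m \<diamondop> vac (m - 1) = vac m"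
proof -
  have act_single: "pre_act u (Poly_Mapping.single k v) = Poly_Mapping.single k (u * v)" for u v k
    by (rule poly_mapping_eqI) (simp add: lookup_pre_act lookup_single when_def)
  have "bM m \<diamondop> vac (m - 1) = abs_fock (pre_act (bM m) (Poly_Mapping.single (m - 1) 1))"
    by (simp add: vac.abs_eq wedge.abs_eq)
  also have "\<dots> = abs_fock (Poly_Mapping.single m 1)"
    using fock_rel.absorb[of 1 m]
    by (simp add: fock.abs_eq_iff act_single pre_act_diff)
  finally show ?thesis by (simp add: vac.abs_eq)
qed

lemma vac_part_any_length:
  assumes "length l \<le> r"
  shows "vac_part m l = b_row r m l \<diamondop> vac (m - int r)"
  using assms
proof (induction rule: dec_induct)
  case base
  show ?case by (simp add: vac_part_def)
next
  case (step n)
  have "b_row (Suc n) m l = b_row n m l * bM (m - int n)"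
    using step.hyps by (simp add: b_row_def part_def)
  then show ?case
    using step.IH bM_wedge_vac[of "m - int n"] by (simp flip: wedge_wedge add: algebra_simps)
qed

section \<open>Extension to the Fock space\<close>

text \<open>
  Cauchy product of series with respect to an action \<open>f\<close> of the coefficients. It is used for the
  wedge product of series and for multiplication by scalar series in one and two variables.
\<close>

definition fps_act ::
    "('r \<Rightarrow> 'm \<Rightarrow> 'm :: comm_monoid_add) \<Rightarrow> 'r fps \<Rightarrow> 'm fps \<Rightarrow> 'm fps"
  where "fps_act f g h = Abs_fps (\<lambda>n. \<Sum>i=0..n. f (fps_nth g i) (fps_nth h (n - i)))"

text \<open>In the following, \<open>\<tau>\<close> is a derivation of \<open>\<And>M\<close> and \<open>v m\<close> the prescribed value at \<open>[b]\<^sub>m\<close>.\<close>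

definition fock_extension ::
    "(ext \<Rightarrow> ext fps) \<Rightarrow> (int \<Rightarrow> fock fps) \<Rightarrow> fock \<Rightarrow> fock fps"
  where "fock_extension \<tau> v =
    (THE T. additive T \<and>
      (\<forall>m l r. is_partition l \<and> length l \<le> r \<longrightarrow>
        T (vac_part m l) = fps_act (\<diamondop>) (\<tau> (b_row r m l)) (v (m - int r))))"

definition sigma_plus_F :: "fock \<Rightarrow> fock fps"
  where "sigma_plus_F = fock_extension sigma_plus
    (\<lambda>m. fps_act (\<diamondop>) (sigma_plus (bM m)) (fps_const (vac (m - 1))))"

definition sigma_minus_F :: "fock \<Rightarrow> fock fps"
  where "sigma_minus_F = fock_extension sigma_minus (\<lambda>m. fps_const (vac m))"

definition sigma_bar_plus_F :: "fock \<Rightarrow> fock fps"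
  where "sigma_bar_plus_F = fock_extension sigma_bar_plus
    (\<lambda>m. Abs_fps (\<lambda>j. int_scale ((- 1) ^ j) (vac_part m (replicate j 1))))"

definition sigma_bar_minus_F :: "fock \<Rightarrow> fock fps"
  where "sigma_bar_minus_F = fock_extension sigma_bar_minus (\<lambda>m. fps_const (vac m))"

section \<open>Series in two variables\<close>

text \<open>
  Both commutation rules live in \<open>F[[p, q\<inverse>]]\<close>, with \<open>(p, q) = (z, w)\<close> in the first and
  \<open>(p, q) = (w, z)\<close> in the second. Such series are represented as series in \<open>p\<close> (outer \<open>fps\<close>) whose
  coefficients are series in \<open>q\<inverse>\<close> (inner \<open>fps\<close>). Applying an operator coefficientwise makes its
  variable the inner one, so a composition whose leftmost operator depends on \<open>p\<close> has to be
  transposed by \<open>fps_swap\<close>.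
\<close>

definition fps_map :: "('a \<Rightarrow> 'c) \<Rightarrow> 'a fps \<Rightarrow> 'c fps"
  where "fps_map T f = Abs_fps (\<lambda>n. T (fps_nth f n))"

definition fps_swap :: "'a fps fps \<Rightarrow> 'a fps fps"
  where "fps_swap f = Abs_fps (\<lambda>i. Abs_fps (\<lambda>j. fps_nth (fps_nth f j) i))"

text \<open>The expansion \<open>\<Sum>\<^sub>k (p/q)\<^sup>k\<close> of \<open>q/(q - p) = 1/(1 - p q\<inverse>)\<close> in powers of \<open>p/q\<close>.\<close>

definition geometric_expansion :: "int fps fps"
  where "geometric_expansion = Abs_fps (\<lambda>i. Abs_fps (\<lambda>j. if i = j then 1 else 0))"

lemma geometric_expansion_inverse:
  "(1 - fps_X * fps_const fps_X) * geometric_expansion = 1"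
proof (rule fps_ext)
  fix n
  show "fps_nth ((1 - fps_X * fps_const fps_X) * geometric_expansion) n = fps_nth 1 n"
    by (cases n; rule fps_ext)
      (auto simp: left_diff_distrib mult.assoc geometric_expansion_def fps_mult_left_const_nth)
qed

definition series_scale :: "int fps fps \<Rightarrow> fock fps fps \<Rightarrow> fock fps fps"
  where "series_scale = fps_act (fps_act int_scale)"

end

theory Submission
  imports Defs
begin

text \<open>
  Each extension \<open>T\<close> of a derivation \<open>\<tau>\<close> satisfies \<open>T (u \<and> x) = \<tau> u \<and> T x\<close>, so \<open>F\<close> is reached from the
  vacua \<open>[b]\<^sub>m\<close> by wedging with basis vectors, and both sides of a commutation rule transform in the
  same way under such a wedge because \<open>\<sigma>\<^sub>+\<close> and \<open>\<sigma>\<^sub>-\<close> (and likewise their inverses) commute on \<open>M\<close>.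
  The rule therefore only has to be checked on \<open>[b]\<^sub>m\<close>. The factor \<open>1/(1 - p q\<inverse>)\<close> is absorbed by
  reading \<open>L = R/(1 - p q\<inverse>)\<close> as \<open>L = R + p q\<inverse> L\<close>.

  The extensions exist because \<open>u \<otimes> [b]\<^sub>m \<mapsto> \<tau> u \<and> v\<^sub>m\<close> respects the relations of \<open>F\<close> as soon as
  \<open>\<tau> b\<^sub>m \<and> v\<^sub>m\<^sub>-\<^sub>1 = v\<^sub>m\<close>, and they are unique because the \<open>[b]\<^sub>m\<^sub>+\<^sub>\<lambda>\<close> span \<open>F\<close>.
\<close>

section \<open>Additive extension to finitely supported functions\<close>

lemma sum_keys_single:
  "(\<Sum>k\<in>Poly_Mapping.keys x. Poly_Mapping.single k (Poly_Mapping.lookup x k)) = x"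
  by (rule poly_mapping_eqI) (simp add: lookup_sum lookup_single when_def in_keys_iff)

lemma poly_mapping_single_induct [case_names single add]:
  fixes x :: "'a \<Rightarrow>\<^sub>0 'b :: comm_monoid_add"
  assumes single: "\<And>k a. P (Poly_Mapping.single k a)"
    and add: "\<And>x y. P x \<Longrightarrow> P y \<Longrightarrow> P (x + y)"
  shows "P x"
proof -
  have "P 0" using single[of undefined 0] by simp
  then have "P (\<Sum>k\<in>A. Poly_Mapping.single k (Poly_Mapping.lookup x k))" for A
    by (induction A rule: infinite_finite_induct) (auto intro: assms)
  then show ?thesis
    by (metis sum_keys_single)
qed

text \<open>The map out of a direct sum induced by additive maps \<open>h k\<close> on the summands.
  It produces maps on the tensor algebra, indexed by words, and on \<open>pre_fock\<close>, indexed
  by charges.\<close>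

definition poly_lift ::
    "('a \<Rightarrow> 'b \<Rightarrow> 'c) \<Rightarrow> ('a \<Rightarrow>\<^sub>0 'b :: ab_group_add) \<Rightarrow> 'c :: ab_group_add"
  where "poly_lift h x = (\<Sum>k\<in>Poly_Mapping.keys x. h k (Poly_Mapping.lookup x k))"

text \<open>Additivity gives \<open>h k 0 = 0\<close>, so indices outside the support contribute
  nothing and different supports can be compared over their union.\<close>

lemma poly_lift_superset:
  assumes "\<And>k. additive (h k)" "finite A" "Poly_Mapping.keys x \<subseteq> A"
  shows "poly_lift h x = (\<Sum>k\<in>A. h k (Poly_Mapping.lookup x k))"
  unfolding poly_lift_def
proof (rule sum.mono_neutral_left[OF assms(2,3)], rule ballI)
  fix k assume "k \<in> A - Poly_Mapping.keys x"
  then show "h k (Poly_Mapping.lookup x k) = 0"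
    using additive.zero[OF assms(1)] by (simp add: in_keys_iff)
qed

lemma additive_poly_lift:
  fixes h :: "'a \<Rightarrow> 'b :: ab_group_add \<Rightarrow> 'c :: ab_group_add"
  assumes h: "\<And>k. additive (h k)"
  shows "additive (poly_lift h)"
proof
  fix x y :: "'a \<Rightarrow>\<^sub>0 'b"
  let ?A = "Poly_Mapping.keys x \<union> Poly_Mapping.keys y"
  have "Poly_Mapping.keys (x + y) \<subseteq> ?A" by (rule keys_add)
  then show "poly_lift h (x + y) = poly_lift h x + poly_lift h y"
    by (simp add: poly_lift_superset[where h = h and A = ?A] h lookup_add additive.add[OF h] sum.distrib)
qed

lemma poly_lift_single:
  assumes "\<And>k. additive (h k)"
  shows "poly_lift h (Poly_Mapping.single k a) = h k a"
  using poly_lift_superset[where h = h and A = "{k}" and x = "Poly_Mapping.single k a"] assms by simp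

section \<open>The exterior algebra\<close>

definition bword :: "int list \<Rightarrow> ext"
  where "bword w = prod_list (map bM w)"

lemma bword_simps [simp]:
  "bword [] = 1" "bword (j # w) = bM j * bword w" "bword (v @ w) = bword v * bword w"
  by (simp_all add: bword_def)

lemma tensor_of_eq: "tensor_of = poly_lift (\<lambda>i. Poly_Mapping.single (Word [i]))"
  by (rule ext) (simp add: tensor_of_def poly_lift_def)

lemma additive_tensor_of: "additive tensor_of"
  unfolding tensor_of_eq by (rule additive_poly_lift) (simp add: additive_def single_add)

lemma tensor_of_single: "tensor_of (Poly_Mapping.single i c) = Poly_Mapping.single (Word [i]) c"
  unfolding tensor_of_eq by (rule poly_lift_single) (simp add: additive_def single_add)

lemma abs_ext_single: "abs_ext (Poly_Mapping.single w c) = of_int c * bword (letters w)"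
proof -
  have word: "abs_ext (Poly_Mapping.single (Word v) 1) = bword v" for v
  proof (induction v)
    case Nil
    show ?case by (simp flip: zero_index_word_def add: one_ext.abs_eq)
  next
    case (Cons j v)
    have "Poly_Mapping.single (Word (j # v)) (1 :: int) =
        Poly_Mapping.single (Word [j]) 1 * Poly_Mapping.single (Word v) 1"
      by (simp add: mult_single plus_index_word_def)
    then show ?case
      using Cons by (simp flip: times_ext.abs_eq add: bM.abs_eq tensor_of_single)
  qed
  have of_nat: "abs_ext (of_nat n) = of_nat n" for n
    by (induction n) (simp_all flip: zero_ext.abs_eq one_ext.abs_eq plus_ext.abs_eq)
  have of_int: "abs_ext (of_int c) = of_int c"
    by (cases c rule: int_cases2) (simp_all flip: uminus_ext.abs_eq add: of_nat)
  have "Poly_Mapping.single w c = of_int c * Poly_Mapping.single w 1"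
    by (simp add: mult_single flip: single_of_int)
  then show ?thesis
    using word[of "letters w"] of_int by (simp flip: times_ext.abs_eq)
qed

lemma ext_abs_cases: obtains x where "u = abs_ext x"
  using Quotient3_ext[THEN Quotient3_abs_rep] by metis

text \<open>An integer multiple is a repeated sum up to sign. With a predicate \<open>P\<close>,
  this removes integer coefficients from later inductions and closure proofs.\<close>

lemma of_int_mult_closed:
  fixes P :: "'a :: ring_1 \<Rightarrow> bool"
  assumes "P 0" "\<And>x y. P x \<Longrightarrow> P y \<Longrightarrow> P (x + y)" "\<And>x. P x \<Longrightarrow> P (- x)" "P x"
  shows "P (of_int c * x)"
proof -
  have "P (of_nat n * x)" for n
    by (induction n) (auto simp: distrib_right intro: assms)
  then show ?thesis
    by (cases c rule: int_cases2) (auto intro: assms)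
qed

lemma ext_word_induct [case_names word add uminus]:
  assumes word: "\<And>w. P (bword w)"
    and add: "\<And>u v. P u \<Longrightarrow> P v \<Longrightarrow> P (u + v)" and uminus: "\<And>u. P u \<Longrightarrow> P (- u)"
  shows "P u"
proof -
  obtain x where u: "u = abs_ext x" by (rule ext_abs_cases)
  \<comment> \<open>The rule has no case for zero, which arises as \<open>bword []\<close> plus its
    negative.\<close>
  have "P 0" using add[OF word uminus[OF word], of "[]" "[]"] by simp
  then have "P (abs_ext x)"
    by (induction x rule: poly_mapping_single_induct)
      (auto simp: abs_ext_single simp flip: plus_ext.abs_eq intro!: of_int_mult_closed assms)
  then show ?thesis by (simp add: u)
qed

text \<open>The image of M. Squares vanish on all of it, and the existence of the derivations rests
  on this.\<close>

definition ext_linear :: "ext set"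
  where "ext_linear = range (\<lambda>v. abs_ext (tensor_of v))"

lemma bM_linear: "bM j \<in> ext_linear"
  by (auto simp: ext_linear_def bM.abs_eq)

lemma ext_linear_0: "0 \<in> ext_linear"
  unfolding ext_linear_def
  by (rule range_eqI[of _ _ 0]) (simp add: zero_ext.abs_eq additive.zero[OF additive_tensor_of])

lemma ext_linear_add: "u \<in> ext_linear \<Longrightarrow> v \<in> ext_linear \<Longrightarrow> u + v \<in> ext_linear"
  unfolding ext_linear_def
  by (auto simp: plus_ext.abs_eq simp flip: additive.add[OF additive_tensor_of])

lemma ext_linear_uminus: "u \<in> ext_linear \<Longrightarrow> - u \<in> ext_linear"
  unfolding ext_linear_def
  by (auto simp: uminus_ext.abs_eq simp flip: additive.minus[OF additive_tensor_of])

lemma ext_linear_of_int_mult: "u \<in> ext_linear \<Longrightarrow> of_int c * u \<in> ext_linear"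
  by (rule of_int_mult_closed[where P = "\<lambda>u. u \<in> ext_linear"])
    (auto intro: ext_linear_0 ext_linear_add ext_linear_uminus)

lemma ext_linear_square: "u \<in> ext_linear \<Longrightarrow> u * u = 0"
  unfolding ext_linear_def
  using ext_ideal.square[of 1 _ 1]
  by (auto simp: times_ext.abs_eq zero_ext.abs_eq ext.abs_eq_iff)

text \<open>Polarization: expand the square of \<open>u + v\<close>.\<close>

lemma ext_linear_anticommute:
  assumes "u \<in> ext_linear" "v \<in> ext_linear"
  shows "u * v = - (v * u)"
proof -
  have "u * v + v * u = (u + v) * (u + v) - u * u - v * v"
    by (simp add: distrib_left distrib_right)
  also have "\<dots> = 0"
    by (simp add: ext_linear_square ext_linear_add assms)
  finally show ?thesis by (simp only: eq_neg_iff_add_eq_0)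
qed

section \<open>Straightening of words\<close>

lemma bM_square: "bM i * bM i = 0"
  by (simp add: ext_linear_square bM_linear)

lemma bM_anticommute: "bM i * bM j = - (bM j * bM i)"
  by (intro ext_linear_anticommute bM_linear)

text \<open>The new letter moves right past larger ones, changing sign each time, until it finds its
  place or meets an equal letter, which kills the product. Length and letters are recorded for
  \<open>bword_eq_0\<close> and \<open>bword_wedge_vac_cases\<close>.\<close>

lemma bM_mult_sorted_bword:
  assumes "sorted_wrt (>) l"
  shows "bM j * bword l = 0 \<or>
    (\<exists>l'. sorted_wrt (>) l' \<and> length l' = Suc (length l) \<and> set l' = insert j (set l) \<and>
      (bM j * bword l = bword l' \<or> bM j * bword l = - bword l'))"
  using assms
proof (induction l)
  case Nil
  show ?case by (intro disjI2 exI[of _ "[j]"]) simp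
next
  case (Cons i l)
  consider "j > i" | "j = i" | "j < i" by linarith
  then show ?case
  proof cases
    case 1
    with Cons.prems have "sorted_wrt (>) (j # i # l)" by auto
    then show ?thesis by (intro disjI2 exI[of _ "j # i # l"]) simp
  next
    case 2
    have "bM j * bword (j # l) = bM j * bM j * bword l" by (simp add: mult.assoc)
    with 2 show ?thesis by (simp add: bM_square)
  next
    case 3
    have "bM j * bword (i # l) = bM j * bM i * bword l"
      by (simp add: mult.assoc)
    also have "\<dots> = - (bM i * (bM j * bword l))"
      by (subst bM_anticommute) (simp add: mult.assoc)
    finally have swap: "bM j * bword (i # l) = - (bM i * (bM j * bword l))" .
    have "sorted_wrt (>) l" using Cons.prems by simp
    from Cons.IH[OF this] consider "bM j * bword l = 0"
      | l' where "sorted_wrt (>) l'" "length l' = Suc (length l)" "set l' = insert j (set l)"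
          "bM j * bword l = bword l' \<or> bM j * bword l = - bword l'"
      by blast
    then show ?thesis
    proof cases
      case 1
      then show ?thesis unfolding swap by simp
    next
      case 2
      then have "sorted_wrt (>) (i # l')"
        using 3 Cons.prems by auto
      moreover have "set (i # l') = insert j (set (i # l))"
        using 2 by auto
      moreover have "bM j * bword (i # l) = bword (i # l') \<or> bM j * bword (i # l) = - bword (i # l')"
        unfolding swap using 2(4) by auto
      ultimately show ?thesis
        using 2(2) by (intro disjI2 exI[of _ "i # l'"]) (simp del: bword_simps)
    qed
  qed
qed

lemma bword_sorted_cases:
  obtains (zero) "bword w = 0"
  | (sorted) l where "sorted_wrt (>) l" "length l = length w" "set l = set w"
      "bword w = bword l \<or> bword w = - bword l"
proof -
  have "bword w = 0 \<or> (\<exists>l. sorted_wrt (>) l \<and> length l = length w \<and> set l = set w \<and>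
      (bword w = bword l \<or> bword w = - bword l))"
  proof (induction w)
    case Nil
    show ?case by (intro disjI2 exI[of _ "[]"]) simp
  next
    case (Cons j w)
    then consider "bword w = 0"
      | l where "sorted_wrt (>) l" "length l = length w" "set l = set w"
          "bword w = bword l \<or> bword w = - bword l"
      by blast
    then show ?case
    proof cases
      case 2
      then have *: "bword (j # w) = bM j * bword l \<or> bword (j # w) = - (bM j * bword l)"
        by auto
      consider "bM j * bword l = 0"
        | l' where "sorted_wrt (>) l'" "length l' = Suc (length l)" "set l' = insert j (set l)"
            "bM j * bword l = bword l' \<or> bM j * bword l = - bword l'"
        using bM_mult_sorted_bword[OF 2(1), of j] by blast
      then show ?thesis
      proof cases
        case 1
        then show ?thesis using * by auto
      next
        case 2
        then have "bword (j # w) = bword l' \<or> bword (j # w) = - bword l'"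
          using * by auto
        then show ?thesis
          using 2 \<open>length l = length w\<close> \<open>set l = set w\<close>
          by (intro disjI2 exI[of _ l']) (simp del: bword_simps)
      qed
    qed simp
  qed
  then show thesis using that by blast
qed

text \<open>Pigeonhole: a word is zero or straightens to a strictly decreasing one, which has as
  many distinct letters as its length.\<close>

lemma bword_eq_0:
  assumes "finite S" "set w \<subseteq> S" "card S < length w"
  shows "bword w = 0"
proof (cases w rule: bword_sorted_cases)
  case (sorted l)
  from sorted(1) have "distinct l" by (induction l) auto
  then have "card (set w) = length w"
    using sorted distinct_card by metis
  then show ?thesis
    using assms card_mono[of S "set w"] by simp
qed

section \<open>Existence and uniqueness of Hasse--Schmidt derivations\<close>

text \<open>A decreasing filtration of the subalgebra on the letters in \<open>S\<close>: products
  add the bounds, and for finite \<open>S\<close> it is zero once \<open>n\<close> exceeds the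
  number of letters.\<close>

inductive_set word_span :: "nat \<Rightarrow> int set \<Rightarrow> ext set" for n S where
  word: "set w \<subseteq> S \<Longrightarrow> n \<le> length w \<Longrightarrow> bword w \<in> word_span n S"
| zero: "0 \<in> word_span n S"
| add: "u \<in> word_span n S \<Longrightarrow> v \<in> word_span n S \<Longrightarrow> u + v \<in> word_span n S"
| uminus: "u \<in> word_span n S \<Longrightarrow> - u \<in> word_span n S"

lemma word_span_mult:
  assumes "u \<in> word_span m S" "v \<in> word_span n S"
  shows "u * v \<in> word_span (m + n) S"
  using assms(1)
proof (induction rule: word_span.induct)
  case (word w)
  note w = word
  from assms(2) show ?case
  proof (induction rule: word_span.induct)
    case (word w')
    have "bword (w @ w') \<in> word_span (m + n) S"
      by (rule word_span.word) (use w word in auto)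
    then show ?case by simp
  qed (simp_all add: distrib_left word_span.zero word_span.add word_span.uminus)
qed (simp_all add: distrib_right word_span.zero word_span.add word_span.uminus)

lemma word_span_eq_0:
  assumes "u \<in> word_span n S" "finite S" "card S < n"
  shows "u = 0"
  using assms(1)
  by (induction rule: word_span.induct) (use assms(2,3) bword_eq_0 in auto)

lemma abs_ext_in_word_span:
  assumes "Poly_Mapping.lookup x 0 = 0"
  obtains S where "finite S" "abs_ext x \<in> word_span 1 S"
proof
  define S where "S = (\<Union>w\<in>Poly_Mapping.keys x. set (letters w))"
  show "finite S" by (auto simp: S_def)
  have "abs_ext (\<Sum>w\<in>A. Poly_Mapping.single w (Poly_Mapping.lookup x w)) \<in> word_span 1 S"
    if "finite A" "A \<subseteq> Poly_Mapping.keys x" for A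
    using that
  proof (induction A rule: finite_induct)
    case empty
    show ?case by (simp flip: zero_ext.abs_eq add: word_span.zero)
  next
    case (insert w A)
    \<comment> \<open>Without a constant term, the empty word does not occur in
      \<open>x\<close>.\<close>
    then have "w \<noteq> 0" using assms by (auto simp: in_keys_iff)
    then have "1 \<le> length (letters w)"
      by (cases w) (auto simp: zero_index_word_def Suc_le_eq)
    moreover have "set (letters w) \<subseteq> S"
      using insert by (auto simp: S_def)
    ultimately have "of_int c * bword (letters w) \<in> word_span 1 S" for c
      by (intro of_int_mult_closed[where P = "\<lambda>u. u \<in> word_span 1 S"])
        (simp_all add: word_span.word word_span.zero word_span.add word_span.uminus)
    then show ?case
      using insert by (simp add: abs_ext_single word_span.add flip: plus_ext.abs_eq)
  qed
  from this[of "Poly_Mapping.keys x"] show "abs_ext x \<in> word_span 1 S"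
    by (simp add: sum_keys_single)
qed

text \<open>A one-letter word is a concatenation only with one factor empty.\<close>

lemma lookup_times_letter:
  "Poly_Mapping.lookup (x * y :: tensor) (Word [j]) =
    Poly_Mapping.lookup x 0 * Poly_Mapping.lookup y (Word [j]) +
    Poly_Mapping.lookup x (Word [j]) * Poly_Mapping.lookup y 0"
proof (induction x rule: poly_mapping_single_induct)
  case (single v a)
  show ?case
  proof (induction y rule: poly_mapping_single_induct)
    case (single w b)
    have "v + w = Word [j] \<longleftrightarrow> v = 0 \<and> w = Word [j] \<or> v = Word [j] \<and> w = 0"
      by (cases v; cases w) (auto simp: zero_index_word_def plus_index_word_def append_eq_Cons_conv)
    moreover have "Word [j] \<noteq> 0" by (simp add: zero_index_word_def)
    ultimately show ?case
      by (auto simp: mult_single lookup_single when_def)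
  next
    case (add y z)
    then show ?case
      by (simp only: distrib_left lookup_add)
  qed
next
  case (add x z)
  then show ?case
    by (simp only: distrib_right lookup_add)
qed

text \<open>Both factors \<open>tensor_of v\<close> of a generator lack a constant term, so the
  generators start in degree two.\<close>

lemma ext_ideal_lookup_letter: "x \<in> ext_ideal \<Longrightarrow> Poly_Mapping.lookup x (Word [j]) = 0"
proof (induction rule: ext_ideal.induct)
  case (square a v c)
  have "Poly_Mapping.lookup (tensor_of v) 0 = 0"
    by (simp add: tensor_of_def lookup_sum lookup_single zero_index_word_def)
  then show ?case by (simp add: lookup_times_letter lookup_times_0)
qed (simp_all add: lookup_add)

text \<open>
  If \<open>u b\<^sub>j = 0\<close>, then \<open>u\<close> has no constant term, so its powers lie in the span of ever longer words
  in finitely many letters.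
\<close>

lemma idempotent_eq_0:
  assumes "u * u = u" "u * bM j = 0"
  shows "u = 0"
proof -
  obtain x where u: "u = abs_ext x" by (rule ext_abs_cases)
  have "x * Poly_Mapping.single (Word [j]) 1 \<in> ext_ideal"
    using assms(2) by (simp add: u bM.abs_eq times_ext.abs_eq zero_ext.abs_eq ext.abs_eq_iff tensor_of_single)
  \<comment> \<open>The coefficient of \<open>Word [j]\<close> in this product is the constant term
    of \<open>x\<close>.\<close>
  from ext_ideal_lookup_letter[OF this, of j] have "Poly_Mapping.lookup x 0 = 0"
    by (simp add: lookup_times_letter lookup_single zero_index_word_def)
  then obtain S where S: "finite S" "u \<in> word_span 1 S"
    unfolding u by (rule abs_ext_in_word_span)
  \<comment> \<open>Each further factor \<open>u\<close> raises the length bound without changing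
    the idempotent.\<close>
  have "u \<in> word_span (Suc n) S" for n
  proof (induction n)
    case (Suc n)
    from word_span_mult[OF S(2) this] show ?case by (simp add: assms(1))
  qed (use S in simp)
  from word_span_eq_0[OF this[of "card S"] S(1)] show ?thesis by simp
qed

text \<open>Every term of coefficient \<open>n\<close> of the square has a vanishing factor: the
  constant coefficient if \<open>i = n\<close>, and otherwise coefficient \<open>i\<close> by
  induction.\<close>

lemma fps_idempotent_eq_0:
  fixes f :: "'a :: ring_1 fps"
  assumes "f * f = f" "fps_nth f 0 = 0"
  shows "f = 0"
proof (rule fps_ext)
  fix n
  have "fps_nth f n = 0"
  proof (induction n rule: less_induct)
    case (less n)
    show ?case
    proof (cases "n = 0")
      case True
      show ?thesis by (simp only: True assms(2))
    next
      case False
      have "fps_nth f n = fps_nth (f * f) n"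
        by (simp only: assms(1))
      also have "\<dots> = (\<Sum>i=0..n. fps_nth f i * fps_nth f (n - i))"
        by (rule fps_mult_nth)
      also have "\<dots> = 0"
      proof (rule sum.neutral, rule ballI)
        fix i assume "i \<in> {0..n}"
        then consider "i = n" | "i < n" by fastforce
        then show "fps_nth f i * fps_nth f (n - i) = 0"
          by cases (simp_all add: less.IH assms(2))
      qed
      finally show ?thesis .
    qed
  qed
  then show "fps_nth f n = fps_nth 0 n" by simp
qed

lemma HS_derivation_0: "HS_derivation D \<Longrightarrow> D 0 = 0"
  by (simp add: HS_derivation_def additive.zero)

text \<open>
  Unitality is not part of \<open>HS_derivation\<close>, so it has to be derived: \<open>1 - D 1\<close> is an idempotent that
  annihilates every \<open>D b\<^sub>j\<close>.
\<close>

lemma HS_derivation_1: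
  assumes D: "HS_derivation D" and lead: "fps_nth (D (bM 0)) 0 = bM 0"
  shows "D 1 = 1"
proof -
  have mult: "D (u * v) = D u * D v" for u v
    using D by (simp add: HS_derivation_def)
  let ?f = "1 - D 1"
  have f: "?f * ?f = ?f" "?f * D (bM 0) = 0"
    by (simp_all add: left_diff_distrib right_diff_distrib flip: mult)
  \<comment> \<open>Constant coefficients are multiplicative, and that of \<open>D (bM 0)\<close> is
    \<open>bM 0\<close>.\<close>
  have "fps_nth ?f 0 * fps_nth ?f 0 = fps_nth ?f 0" "fps_nth ?f 0 * bM 0 = 0"
    using f[THEN arg_cong, of "\<lambda>g. fps_nth g 0"] by (simp_all only: fps_mult_nth_0 lead fps_zero_nth)
  then have "fps_nth ?f 0 = 0" by (rule idempotent_eq_0)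
  with f(1) have "?f = 0" by (rule fps_idempotent_eq_0)
  then show ?thesis by simp
qed

text \<open>Unitality fixes the value on the empty word and multiplicativity the values on all
  words, which generate \<open>ext\<close> additively.\<close>

lemma HS_derivation_unique:
  assumes D: "HS_derivation D" and E: "HS_derivation E"
    and eq: "\<And>j. D (bM j) = E (bM j)" and lead: "fps_nth (E (bM 0)) 0 = bM 0"
  shows "D = E"
proof
  fix u
  have mult: "D (u * v) = D u * D v" "E (u * v) = E u * E v" for u v
    using D E by (simp_all add: HS_derivation_def)
  have add: "additive D" "additive E"
    using D E by (simp_all add: HS_derivation_def)
  have one: "D 1 = 1" "E 1 = 1"
    using HS_derivation_1[OF D] HS_derivation_1[OF E] by (simp_all add: eq lead)
  show "D u = E u"
  proof (induction u rule: ext_word_induct)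
    case (word w)
    show ?case by (induction w) (simp_all add: one mult eq)
  qed (simp_all add: additive.add[OF add(1)] additive.add[OF add(2)]
      additive.minus[OF add(1)] additive.minus[OF add(2)])
qed

text \<open>
  Writing \<open>f = c + z g\<close> gives \<open>f\<^sup>2 = z\<^sup>2 g\<^sup>2\<close>; halving \<open>f\<^sup>2 = - f\<^sup>2\<close> instead would need a torsion-free
  coefficient ring.
\<close>

lemma fps_alternating_square:
  fixes f :: "'a :: ring_1 fps"
  assumes "\<And>i. fps_nth f i * fps_nth f i = 0"
    and "\<And>i j. fps_nth f i * fps_nth f j = - (fps_nth f j * fps_nth f i)"
  shows "f * f = 0"
proof (rule fps_ext)
  fix n
  have "fps_nth (f * f) n = 0"
    using assms
  proof (induction n arbitrary: f rule: less_induct)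
    case (less n)
    let ?c = "fps_const (fps_nth f 0)" and ?g = "fps_shift (Suc 0) f"
    have f: "f = ?c + fps_X * ?g"
      by (rule fps_ext) simp
    have c: "?c * ?c = 0" by (simp add: less.prems(1))
    have "?c * ?g + ?g * ?c = 0"
    proof (rule fps_ext)
      fix k
      show "fps_nth (?c * ?g + ?g * ?c) k = fps_nth 0 k"
        using less.prems(2)[of 0 "Suc k"] by simp
    qed
    then have *: "fps_X * (?c * ?g) + fps_X * (?g * ?c) = 0"
      by (metis distrib_left mult_zero_right)
    have X: "h * (fps_X * k) = fps_X * (h * k)" for h k :: "'a fps"
      by (metis fps_mult_fps_X_commute mult.assoc)
    have "f * f = (?c + fps_X * ?g) * (?c + fps_X * ?g)" using f by simp
    also have "\<dots> = ?c * ?c + (fps_X * (?c * ?g) + fps_X * (?g * ?c)) + fps_X * (fps_X * (?g * ?g))"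
      by (simp add: distrib_left distrib_right mult.assoc X[of ?g] X[of ?c])
    also have "\<dots> = fps_X * (fps_X * (?g * ?g))" using c * by simp
    finally have "fps_nth (f * f) n = fps_nth (fps_X * (fps_X * (?g * ?g))) n" by simp
    also have "\<dots> = 0"
    \<comment> \<open>Below degree two the factor \<open>fps_X\<close> squared gives zero. Otherwise
      induction applies at \<open>n - 2\<close> to the shifted series, which inherits both
      assumptions.\<close>
    proof (cases "n < 2")
      case False
      then have "fps_nth (?g * ?g) (n - 2) = 0"
      proof (intro less.IH)
        show "n - 2 < n" using False by simp
      qed (unfold fps_shift_nth, rule less.prems(1), rule less.prems(2))
      then show ?thesis using False by (simp add: numeral_2_eq_2)
    qed auto
    finally show ?case .
  qed
  then show "fps_nth (f * f) n = fps_nth 0 n" by simp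
qed

text \<open>The tensor algebra is free, so letters may be sent to the \<open>\<beta> j\<close> and
  words to products. The map descends because M is sent to series with coefficients in
  \<open>ext_linear\<close>, whose squares vanish.\<close>

lemma HS_derivation_exists:
  assumes linear: "\<And>j n. fps_nth (\<beta> j) n \<in> ext_linear"
  obtains D where "HS_derivation D" "\<And>j. D (bM j) = \<beta> j"
proof -
  let ?h = "\<lambda>w c. of_int c * prod_list (map \<beta> (letters w))"
  define D0 where "D0 = poly_lift ?h"
  have h: "additive (?h w)" for w
    by (simp add: additive_def distrib_right)
  have add: "additive D0"
    unfolding D0_def by (rule additive_poly_lift) (rule h)
  have single: "D0 (Poly_Mapping.single w c) = ?h w c" for w c
    unfolding D0_def by (rule poly_lift_single) (rule h)
  note D0_add = additive.add[OF add]
  have mult: "D0 (x * y) = D0 x * D0 y" for x y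
  proof (induction x rule: poly_mapping_single_induct)
    case (single v a)
    show ?case
    proof (induction y rule: poly_mapping_single_induct)
      case (single w b)
      show ?case
        unfolding mult_single \<open>\<And>w c. D0 (Poly_Mapping.single w c) = ?h w c\<close>
        by (simp add: plus_index_word_def mult.assoc)
          (metis (no_types, opaque_lifting) mult.assoc mult_of_int_commute)
    qed (simp add: distrib_left D0_add)
  qed (simp add: distrib_right D0_add)
  \<comment> \<open>The ideal is generated by squares of all vectors of M, so a general
    \<open>v\<close> is treated and not only a letter.\<close>
  have coeffs: "fps_nth (D0 (tensor_of v)) n \<in> ext_linear" for v n
  proof (induction v rule: poly_mapping_single_induct)
    case (single i c)
    show ?case
      by (simp add: tensor_of_single \<open>\<And>w c. D0 (Poly_Mapping.single w c) = ?h w c\<close>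
          ext_linear_of_int_mult linear flip: fps_of_int)
  qed (simp add: additive.add[OF additive_tensor_of] D0_add ext_linear_add)
  have "D0 (tensor_of v) * D0 (tensor_of v) = 0" for v
    by (rule fps_alternating_square) (intro ext_linear_square ext_linear_anticommute coeffs)+
  note square = this
  have ideal: "D0 x = 0" if "x \<in> ext_ideal" for x
    using that
    by (induction rule: ext_ideal.induct) (simp_all add: mult square D0_add additive.zero[OF add])
  \<comment> \<open>The choice of representative is harmless because \<open>D0\<close> vanishes on
    the ideal.\<close>
  define D where "D = (\<lambda>u. D0 (rep_ext u))"
  have D_abs: "D (abs_ext x) = D0 x" for x
  proof -
    have "abs_ext (rep_ext (abs_ext x)) = abs_ext x"
      using Quotient3_ext by (rule Quotient3_abs_rep)
    then have "rep_ext (abs_ext x) - x \<in> ext_ideal"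
      by (simp add: ext.abs_eq_iff)
    then show ?thesis
      using ideal additive.diff[OF add, of "rep_ext (abs_ext x)" x] by (simp add: D_def)
  qed
  show thesis
  proof
    show "HS_derivation D"
      unfolding HS_derivation_def additive_def
    proof (intro conjI allI)
      fix u v
      obtain x y where "u = abs_ext x" "v = abs_ext y"
        by (metis ext_abs_cases)
      then show "D (u + v) = D u + D v" "D (u * v) = D u * D v"
        by (simp_all add: plus_ext.abs_eq times_ext.abs_eq D_abs D0_add mult)
    qed
    show "D (bM j) = \<beta> j" for j
      by (simp add: bM.abs_eq D_abs tensor_of_single single)
  qed
qed

text \<open>Turns the definite descriptions into usable facts. The assumption on
  \<open>\<beta> 0\<close> supplies the unitality on which uniqueness depends.\<close>

lemma HS_derivation_THE:
  assumes "\<And>j n. fps_nth (\<beta> j) n \<in> ext_linear" "fps_nth (\<beta> 0) 0 = bM 0"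
    and D: "D = (THE D. HS_derivation D \<and> (\<forall>j. D (bM j) = \<beta> j))"
  shows "HS_derivation D" "D (bM j) = \<beta> j" "D 1 = 1"
proof -
  obtain E where E: "HS_derivation E" "\<And>j. E (bM j) = \<beta> j"
    using HS_derivation_exists assms(1) by blast
  have "HS_derivation D \<and> (\<forall>j. D (bM j) = \<beta> j)"
    unfolding D
  proof (rule theI[where P = "\<lambda>D. HS_derivation D \<and> (\<forall>j. D (bM j) = \<beta> j)"])
    show "HS_derivation E \<and> (\<forall>j. E (bM j) = \<beta> j)" using E by simp
    show "E' = E" if "HS_derivation E' \<and> (\<forall>j. E' (bM j) = \<beta> j)" for E'
      by (rule HS_derivation_unique) (use that E assms(2) in auto)
  qed
  then show "HS_derivation D" "D (bM j) = \<beta> j" by simp_all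
  then show "D 1 = 1"
    using HS_derivation_1[of D] \<open>HS_derivation D \<and> _\<close> assms(2) by simp
qed

lemma
  shows HS_sigma_plus: "HS_derivation sigma_plus" "sigma_plus 1 = 1"
    and sigma_plus_bM: "sigma_plus (bM j) = Abs_fps (\<lambda>i. bM (j + int i))"
  by (rule HS_derivation_THE[OF _ _ sigma_plus_def]; simp add: bM_linear)+

lemma
  shows HS_sigma_minus: "HS_derivation sigma_minus" "sigma_minus 1 = 1"
    and sigma_minus_bM: "sigma_minus (bM j) = Abs_fps (\<lambda>i. bM (j - int i))"
  by (rule HS_derivation_THE[OF _ _ sigma_minus_def]; simp add: bM_linear)+

lemma binomial_series_linear:
  "fps_nth (fps_const (bM i) - fps_const (bM j) * fps_X) n \<in> ext_linear"
  using ext_linear_add[OF bM_linear[of i] ext_linear_uminus[OF bM_linear[of j]]]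
  by (auto simp: bM_linear ext_linear_0 ext_linear_uminus fps_X_nth)

lemma
  shows HS_sigma_bar_plus: "HS_derivation sigma_bar_plus" "sigma_bar_plus 1 = 1"
    and sigma_bar_plus_bM:
      "sigma_bar_plus (bM j) = fps_const (bM j) - fps_const (bM (j + 1)) * fps_X"
  by (rule HS_derivation_THE[OF _ _ sigma_bar_plus_def];
      (rule binomial_series_linear | simp))+

lemma
  shows HS_sigma_bar_minus: "HS_derivation sigma_bar_minus" "sigma_bar_minus 1 = 1"
    and sigma_bar_minus_bM:
      "sigma_bar_minus (bM j) = fps_const (bM j) - fps_const (bM (j - 1)) * fps_X"
  by (rule HS_derivation_THE[OF _ _ sigma_bar_minus_def];
      (rule binomial_series_linear | simp))+

section \<open>The Fock space\<close>

lemma wedge_add_left: "(u + v) \<diamondop> x = u \<diamondop> x + v \<diamondop> x"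
proof transfer
  fix u v x
  have "pre_act (u + v) x = pre_act u x + pre_act v x"
    by (rule poly_mapping_eqI) (simp add: lookup_pre_act lookup_add distrib_right)
  then show "pre_act (u + v) x - (pre_act u x + pre_act v x) \<in> fock_rel"
    by (simp add: fock_rel.zero)
qed

lemma wedge_add_right: "u \<diamondop> (x + y) = u \<diamondop> x + u \<diamondop> y"
  by transfer (simp add: pre_act_add fock_rel.zero)

lemma additive_wedge_left: "additive (\<lambda>u. u \<diamondop> x)"
  by (simp add: additive_def wedge_add_left)

lemma additive_wedge_right: "additive ((\<diamondop>) u)"
  by (simp add: additive_def wedge_add_right)

lemma wedge_uminus_left [simp]: "(- u) \<diamondop> x = - (u \<diamondop> x)"
  using additive.minus[OF additive_wedge_left] .

lemma zero_wedge [simp]: "0 \<diamondop> x = 0"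
  using additive.zero[OF additive_wedge_left] .

lemma wedge_uminus_right [simp]: "u \<diamondop> (- x) = - (u \<diamondop> x)"
  using additive.minus[OF additive_wedge_right] .

lemma wedge_zero [simp]: "u \<diamondop> 0 = 0"
  using additive.zero[OF additive_wedge_right] .

lemma fock_abs_cases: obtains y where "x = abs_fock y"
  using Quotient3_fock[THEN Quotient3_abs_rep] by metis

lemma one_wedge [simp]: "1 \<diamondop> x = x"
proof (cases x rule: fock_abs_cases)
  fix y assume x: "x = abs_fock y"
  have "pre_act 1 y = y"
    by (rule poly_mapping_eqI) (simp add: lookup_pre_act)
  then show ?thesis by (simp add: x wedge.abs_eq)
qed

lemma abs_fock_single: "abs_fock (Poly_Mapping.single m u) = u \<diamondop> vac m"
proof -
  have "pre_act u (Poly_Mapping.single m 1) = Poly_Mapping.single m u"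
    by (rule poly_mapping_eqI) (simp add: lookup_pre_act lookup_single when_def)
  then show ?thesis by (simp add: vac.abs_eq wedge.abs_eq)
qed

lemma fock_word_induct [case_names word add uminus]:
  assumes word: "\<And>w m. P (bword w \<diamondop> vac m)"
    and add: "\<And>x y. P x \<Longrightarrow> P y \<Longrightarrow> P (x + y)" and uminus: "\<And>x. P x \<Longrightarrow> P (- x)"
  shows "P x"
proof -
  obtain y where x: "x = abs_fock y" by (rule fock_abs_cases)
  have "P (abs_fock y)"
  proof (induction y rule: poly_mapping_single_induct)
    case (single m u)
    have "P (u \<diamondop> vac m)"
      by (induction u rule: ext_word_induct) (simp_all add: wedge_add_left assms)
    then show ?case by (simp add: abs_fock_single)
  next
    case (add x y)
    then show ?case by (simp add: assms(2) flip: plus_fock.abs_eq)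
  qed
  then show ?thesis by (simp add: x)
qed

lemma fock_induct [case_names vac wedge add uminus]:
  assumes vac: "\<And>m. P (vac m)" and wedge: "\<And>j x. P x \<Longrightarrow> P (bM j \<diamondop> x)"
    and add: "\<And>x y. P x \<Longrightarrow> P y \<Longrightarrow> P (x + y)" and uminus: "\<And>x. P x \<Longrightarrow> P (- x)"
  shows "P x"
proof (induction x rule: fock_word_induct)
  case (word w m)
  show ?case
    by (induction w) (simp_all add: vac wedge flip: wedge_wedge)
qed (rule add uminus; assumption)+

text \<open>The vacuum contains \<open>b_j\<close> as a factor. Induction starts at
  \<open>m = j\<close>, where \<open>b_j\<close> squares to zero, and moves \<open>b_j\<close> past
  each newly added vector.\<close>

lemma bM_wedge_vac_eq_0:
  assumes "j \<le> m"
  shows "bM j \<diamondop> vac m = 0"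
  using assms
proof (induction m rule: int_ge_induct)
  case base
  show ?case
    by (metis bM_wedge_vac wedge_wedge bM_square zero_wedge)
next
  case (step m)
  have "bM j \<diamondop> vac (m + 1) = (bM j * bM (m + 1)) \<diamondop> vac m"
    using bM_wedge_vac[of "m + 1"] by (simp flip: wedge_wedge)
  also have "\<dots> = - (bM (m + 1) \<diamondop> bM j \<diamondop> vac m)"
    by (subst bM_anticommute) (simp add: wedge_wedge)
  also have "\<dots> = 0" by (simp add: step.IH)
  finally show ?case .
qed

section \<open>Spanning by the elements \<open>[b]_{m+\<lambda>}\<close>\<close>

lemma b_row_eq_bword: "b_row r m l = bword (map (\<lambda>i. m - int i + int (part l i)) [0..<r])"
  by (simp add: b_row_def bword_def comp_def)

lemma vac_eq_b_row_wedge: "vac m = b_row k m [] \<diamondop> vac (m - int k)"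
  using vac_part_any_length[of "[]" k m] by (simp add: vac_part_def b_row_def)

text \<open>Subtracting the staircase from a strictly decreasing sequence leaves a weakly decreasing
  one, a partition padded with zeros.\<close>

lemma sorted_eq_b_row_indices:
  assumes "sorted_wrt (>) l" "\<And>i. i \<in> set l \<Longrightarrow> i > m"
  shows "\<exists>p. is_partition p \<and> length p \<le> length l \<and>
    l = map (\<lambda>i. m + int (length l) - int i + int (part p i)) [0..<length l]"
  using assms
proof (induction l)
  case Nil
  show ?case by (intro exI[of _ "[]"]) (simp add: is_partition_def)
next
  case (Cons x l)
  let ?r = "length l"
  have "sorted_wrt (>) l" "\<And>i. i \<in> set l \<Longrightarrow> i > m"
    using Cons.prems by simp_all
  from Cons.IH[OF this] obtain p where p: "is_partition p" "length p \<le> ?r"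
    and l: "l = map (\<lambda>i. m + int ?r - int i + int (part p i)) [0..<?r]"
    by blast
  have nth: "l ! i = m + int ?r - int i + int (part p i)" if "i < ?r" for i
    using arg_cong[OF l, of "\<lambda>l. l ! i"] that by simp
  \<comment> \<open>The next entry, if any, is \<open>m + ?r + part p 0\<close>, so strict decrease
    makes the new part at least \<open>part p 0\<close>.\<close>
  have x: "m + int ?r + int (part p 0) < x"
  proof (cases l)
    case Nil
    then show ?thesis using Cons.prems p by (simp add: part_def)
  next
    case Cons': (Cons y l')
    then have "x > y" using Cons.prems by simp
    then show ?thesis using nth[of 0] Cons' by simp
  qed
  \<comment> \<open>\<open>d\<close> is the excess of \<open>x\<close> over its value for the empty
    partition. If it is zero then \<open>p\<close> is empty too, and \<open>q\<close> must be empty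
    since parts are positive.\<close>
  define d where "d = nat (x - (m + int ?r + 1))"
  define q where "q = (if d = 0 then [] else d # p)"
  have d: "x = m + int ?r + 1 + int d" "part p 0 \<le> d"
    using x by (simp_all add: d_def)
  have p_le: "p ! i \<le> part p 0" if "i < length p" for i
    using that p(1)
    by (cases p; cases i) (simp_all add: is_partition_def part_def)
  have p_nil: "p = []" if "d = 0"
    using d(2) p(1) unfolding that by (cases p) (auto simp: part_def is_partition_def)
  have part_q: "part q 0 = d" "part q (Suc i) = part p i" for i
    using p_nil by (cases "d = 0"; simp add: q_def part_def)+
  have "a \<le> d" if "a \<in> set p" for a
  proof -
    from that obtain i where "i < length p" "a = p ! i" by (auto simp: in_set_conv_nth)
    then show ?thesis using p_le[of i] d(2) by simp
  qed
  then have "is_partition q"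
    using p(1) by (auto simp: is_partition_def q_def)
  moreover have "length q \<le> length (x # l)"
    using p(2) by (simp add: q_def)
  moreover have "x # l = map (\<lambda>i. m + int (length (x # l)) - int i + int (part q i)) [0..<length (x # l)]"
  proof (rule nth_equalityI)
    fix i assume "i < length (x # l)"
    then show "(x # l) ! i = map (\<lambda>i. m + int (length (x # l)) - int i + int (part q i)) [0..<length (x # l)] ! i"
      by (cases i) (simp_all del: upt_Suc add: part_q d(1) nth)
  qed simp
  ultimately show ?case by (intro exI[of _ q] conjI)
qed

text \<open>Enough vectors are split off the vacuum for all letters of \<open>w\<close> to lie above
  the rest; the combined word is then straightened.\<close>

lemma bword_wedge_vac_cases:
  obtains (zero) "bword w \<diamondop> vac m = 0"
  | (vac_part) k p where "is_partition p"
      "bword w \<diamondop> vac m = vac_part k p \<or> bword w \<diamondop> vac m = - vac_part k p"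
proof -
  obtain k where k: "\<And>i. i \<in> set w \<Longrightarrow> m - int k < i"
  proof
    fix i assume "i \<in> set w"
    then have "Min (insert m (set w)) \<le> i" by simp
    moreover have "Min (insert m (set w)) \<le> m" by simp
    ultimately show "m - int (nat (m - Min (insert m (set w)) + 1)) < i"
      by linarith
  qed
  define v where "v = w @ map (\<lambda>i. m - int i + int (part [] i)) [0..<k]"
  have v: "bword w \<diamondop> vac m = bword v \<diamondop> vac (m - int k)"
    by (subst vac_eq_b_row_wedge[of m k]) (simp add: v_def wedge_wedge b_row_eq_bword)
  have gt: "m - int k < i" if "i \<in> set v" for i
    using that k by (auto simp: v_def part_def)
  show thesis
  proof (cases v rule: bword_sorted_cases)
    case zero
    then show ?thesis using that(1) by (simp add: v)
  next
    case (sorted l)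
    obtain p where p: "is_partition p" "length p \<le> length l"
      and l: "l = map (\<lambda>i. m - int k + int (length l) - int i + int (part p i)) [0..<length l]"
      using sorted_eq_b_row_indices[OF sorted(1), of "m - int k"] gt sorted(3) by blast
    have "bword l = b_row (length l) (m - int k + int (length l)) p"
      using arg_cong[OF l, of bword] by (simp only: b_row_eq_bword)
    then have "bword l \<diamondop> vac (m - int k) = vac_part (m - int k + int (length l)) p"
      by (simp add: vac_part_any_length[OF p(2)])
    then show ?thesis
      using that(2)[OF p(1), of "m - int k + int (length l)"] sorted(4)
      by (auto simp: v)
  qed
qed

lemma additive_fock_eqI:
  fixes T U :: "fock \<Rightarrow> 'a :: ab_group_add"
  assumes T: "additive T" and U: "additive U"
    and eq: "\<And>m l. is_partition l \<Longrightarrow> T (vac_part m l) = U (vac_part m l)"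
  shows "T = U"
proof
  fix x
  show "T x = U x"
  proof (induction x rule: fock_word_induct)
    case (word w m)
    show ?case
    proof (cases w m rule: bword_wedge_vac_cases)
      case zero
      then show ?thesis by (simp add: additive.zero[OF T] additive.zero[OF U])
    next
      case (vac_part k p)
      then show ?thesis
        using eq by (auto simp: additive.minus[OF T] additive.minus[OF U])
    qed
  qed (simp_all add: additive.add[OF T] additive.add[OF U] additive.minus[OF T] additive.minus[OF U])
qed

section \<open>Actions of series\<close>

lemma fps_nth_fps_act: "fps_nth (fps_act f g h) n = (\<Sum>i=0..n. f (fps_nth g i) (fps_nth h (n - i)))"
  by (simp add: fps_act_def)

lemma additive_fps_act_left:
  fixes f :: "'r :: ab_group_add \<Rightarrow> 'm :: ab_group_add \<Rightarrow> 'm"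
  assumes "\<And>x. additive (\<lambda>u. f u x)"
  shows "additive (\<lambda>u. fps_act f u x)"
  by standard (auto intro!: fps_ext simp: fps_nth_fps_act additive.add[OF assms] sum.distrib)

lemma additive_fps_act_right:
  fixes f :: "'r :: ab_group_add \<Rightarrow> 'm :: ab_group_add \<Rightarrow> 'm"
  assumes "\<And>u. additive (f u)"
  shows "additive (fps_act f u)"
  by standard (auto intro!: fps_ext simp: fps_nth_fps_act additive.add[OF assms] sum.distrib)

text \<open>Both sides sum over all \<open>i + j + k = n\<close>.\<close>

lemma fps_act_assoc:
  fixes f :: "'r :: ring_1 \<Rightarrow> 'm :: ab_group_add \<Rightarrow> 'm"
  assumes left: "\<And>x. additive (\<lambda>u. f u x)" and right: "\<And>u. additive (f u)"
    and assoc: "\<And>u v x. f (u * v) x = f u (f v x)"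
  shows "fps_act f (u * v) x = fps_act f u (fps_act f v x)"
proof (rule fps_ext)
  fix n
  let ?t = "\<lambda>i j k. f (fps_nth u i) (f (fps_nth v j) (fps_nth x k))"
  have "fps_nth (fps_act f (u * v) x) n = (\<Sum>k=0..n. \<Sum>i=0..k. ?t i (k - i) (n - k))"
    by (simp add: fps_nth_fps_act fps_mult_nth additive.sum[OF left] assoc)
  also have "\<dots> = (\<Sum>i=0..n. \<Sum>j=0..n - i. ?t i j (n - i - j))"
    by (rule fps_mult_assoc_lemma)
  also have "\<dots> = fps_nth (fps_act f u (fps_act f v x)) n"
    by (simp add: fps_nth_fps_act additive.sum[OF right])
  finally show "fps_nth (fps_act f (u * v) x) n = fps_nth (fps_act f u (fps_act f v x)) n" .
qed

lemma fps_act_one: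
  assumes "\<And>x. f 1 x = x" "\<And>x. f 0 x = 0"
  shows "fps_act f 1 x = x"
  by (rule fps_ext) (simp add: fps_nth_fps_act assms sum.atLeast_Suc_atMost)

lemmas wedge_series_assoc = fps_act_assoc[OF additive_wedge_left additive_wedge_right wedge_wedge[symmetric]]

section \<open>Existence of the extensions\<close>

text \<open>Assumption \<open>v\<close> is compatibility with the relation \<open>absorb\<close>.
  Compatibility with \<open>kill\<close> follows from it, because \<open>\<tau> (bM m)\<close>
  squares to zero.\<close>

lemma
  fixes \<tau> :: "ext \<Rightarrow> ext fps" and v :: "int \<Rightarrow> fock fps"
  assumes HS: "HS_derivation \<tau>" "\<tau> 1 = 1"
    and v: "\<And>m. fps_act (\<diamondop>) (\<tau> (bM m)) (v (m - 1)) = v m"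
  shows additive_fock_extension: "additive (fock_extension \<tau> v)"
    and fock_extension_wedge: "fock_extension \<tau> v (u \<diamondop> x) = fps_act (\<diamondop>) (\<tau> u) (fock_extension \<tau> v x)"
    and fock_extension_vac: "fock_extension \<tau> v (vac m) = v m"
proof -
  let ?act = "fps_act (\<diamondop>)"
  let ?h = "\<lambda>m u. ?act (\<tau> u) (v m)"
  define T0 where "T0 = poly_lift ?h"
  have mult: "\<tau> (u * v) = \<tau> u * \<tau> v" for u v
    using HS by (simp add: HS_derivation_def)
  have \<tau>: "additive \<tau>"
    using HS by (simp add: HS_derivation_def)
  note act_left = additive_fps_act_left[of "(\<diamondop>)", OF additive_wedge_left]
  note act_right = additive_fps_act_right[of "(\<diamondop>)", OF additive_wedge_right]
  have h: "additive (?h m)" for m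
    by (simp add: additive_def additive.add[OF \<tau>] additive.add[OF act_left])
  have add: "additive T0"
    unfolding T0_def by (rule additive_poly_lift) (rule h)
  have single: "T0 (Poly_Mapping.single m u) = ?act (\<tau> u) (v m)" for m u
    unfolding T0_def by (rule poly_lift_single) (rule h)
  have act: "T0 (pre_act u x) = ?act (\<tau> u) (T0 x)" for u x
  proof (induction x rule: poly_mapping_single_induct)
    case (single m w)
    have "pre_act u (Poly_Mapping.single m w) = Poly_Mapping.single m (u * w)"
      by (rule poly_mapping_eqI) (simp add: lookup_pre_act lookup_single when_def)
    then show ?case
      by (simp add: \<open>\<And>m u. T0 (Poly_Mapping.single m u) = _ m u\<close> mult wedge_series_assoc)
  next
    case (add x y)
    then show ?case
      by (simp add: pre_act_add additive.add[OF act_right] additive.add[OF \<open>additive T0\<close>])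
  qed
  have kill: "?act (\<tau> (bM m)) (v m) = 0" for m
  proof -
    have "?act (\<tau> (bM m)) (v m) = ?act (\<tau> (bM m * bM m)) (v (m - 1))"
      by (simp add: mult wedge_series_assoc v)
    then show ?thesis
      by (simp add: bM_square additive.zero[OF \<tau>] additive.zero[OF act_left])
  qed
  have rel: "T0 x = 0" if "x \<in> fock_rel" for x
    using that
    by (induction rule: fock_rel.induct)
      (simp_all add: act single kill v HS(2) fps_act_one additive.zero[OF add] additive.add[OF add]
        additive.diff[OF add] additive.zero[OF act_right])
  define T where "T = (\<lambda>x. T0 (rep_fock x))"
  have T_abs: "T (abs_fock x) = T0 x" for x
  proof -
    have "abs_fock (rep_fock (abs_fock x)) = abs_fock x"
      using Quotient3_fock by (rule Quotient3_abs_rep)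
    then have "rep_fock (abs_fock x) - x \<in> fock_rel"
      by (simp add: fock.abs_eq_iff)
    then show ?thesis
      using rel additive.diff[OF add, of "rep_fock (abs_fock x)" x] by (simp add: T_def)
  qed
  have T_add: "additive T"
  proof
    fix x y
    obtain x' y' where "x = abs_fock x'" "y = abs_fock y'" by (metis fock_abs_cases)
    then show "T (x + y) = T x + T y"
      by (simp add: plus_fock.abs_eq T_abs additive.add[OF add])
  qed
  have T_wedge: "T (u \<diamondop> x) = ?act (\<tau> u) (T x)" for u x
    by (cases x rule: fock_abs_cases) (simp add: wedge.abs_eq T_abs act)
  have T_vac: "T (vac m) = v m" for m
    by (simp add: vac.abs_eq T_abs single HS(2) fps_act_one)
  let ?P = "\<lambda>T. additive T \<and> (\<forall>m l r. is_partition l \<and> length l \<le> r \<longrightarrow>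
        T (vac_part m l) = ?act (\<tau> (b_row r m l)) (v (m - int r)))"
  have "fock_extension \<tau> v = T"
    unfolding fock_extension_def
  proof (rule the_equality[where P = ?P])
    \<comment> \<open>\<open>vac_part\<close> may be written with any admissible \<open>r\<close>,
      so the prescribed values are mutually consistent.\<close>
    have "T (vac_part m l) = ?act (\<tau> (b_row r m l)) (v (m - int r))"
      if "length l \<le> r" for m l r
      by (simp only: vac_part_any_length[OF that] T_wedge T_vac)
    then show "?P T" using T_add by blast
    \<comment> \<open>Taking \<open>r = length l\<close> shows agreement on the spanning
      set.\<close>
    then show "U = T" if "?P U" for U
      using that by (intro additive_fock_eqI) (blast, blast, metis order_refl)
  qed
  then show "additive (fock_extension \<tau> v)"
    "fock_extension \<tau> v (u \<diamondop> x) = ?act (\<tau> u) (fock_extension \<tau> v x)"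
    "fock_extension \<tau> v (vac m) = v m"
    by (simp_all add: T_add T_wedge T_vac)
qed

lemma fps_act_const_right:
  assumes "\<And>u. f u 0 = 0"
  shows "fps_nth (fps_act f g (fps_const x)) n = f (fps_nth g n) x"
proof -
  have "fps_nth (fps_act f g (fps_const x)) n = (\<Sum>i=0..n. if i = n then f (fps_nth g i) x else 0)"
    unfolding fps_nth_fps_act by (rule sum.cong) (auto simp: assms)
  then show ?thesis by simp
qed

lemma fps_act_binomial:
  fixes f :: "'r :: ring_1 \<Rightarrow> 'm :: ab_group_add \<Rightarrow> 'm"
  assumes f: "\<And>x. additive (\<lambda>u. f u x)"
  shows "fps_nth (fps_act f (fps_const a - fps_const b * fps_X) h) n =
    f a (fps_nth h n) - (if n = 0 then 0 else f b (fps_nth h (n - 1)))"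
proof -
  have coeff: "fps_nth (fps_const a - fps_const b * fps_X) i =
      (if i = 0 then a else if i = 1 then - b else 0)" for i
    by (cases i) (auto simp: fps_X_nth)
  show ?thesis
  proof (cases n)
    case 0
    then show ?thesis by (simp add: fps_nth_fps_act)
  next
    case (Suc k)
    let ?c = "fps_nth (fps_const a - fps_const b * fps_X)"
    have "fps_nth (fps_act f (fps_const a - fps_const b * fps_X) h) n =
        f (?c 0) (fps_nth h (Suc k)) + (\<Sum>i=0..k. f (?c (Suc i)) (fps_nth h (k - i)))"
      unfolding Suc fps_nth_fps_act sum.atLeast0_atMost_Suc_shift comp_def diff_Suc_Suc diff_zero ..
    also have "(\<Sum>i=0..k. f (?c (Suc i)) (fps_nth h (k - i))) =
        (\<Sum>i=0..k. if i = 0 then - f b (fps_nth h k) else 0)"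
      unfolding coeff by (rule sum.cong) (simp_all add: additive.zero[OF f] additive.minus[OF f])
    finally show ?thesis unfolding coeff by (simp add: Suc)
  qed
qed

lemmas wedge_series_const = fps_act_const_right[where f = "(\<diamondop>)", OF wedge_zero]
lemmas wedge_series_binomial = fps_act_binomial[OF additive_wedge_left]

section \<open>Compatibility of the prescribed vacuum values\<close>

text \<open>The series at \<open>b_{m-1}\<close> is \<open>b_{m-1}\<close> plus \<open>z\<close>
  times the series at \<open>b_m\<close>. The latter squares to zero, so only \<open>b_{m-1}\<close>
  survives, and the vacuum absorbs it.\<close>

lemma sigma_plus_F_compatible:
  "fps_act (\<diamondop>) (sigma_plus (bM m))
      (fps_act (\<diamondop>) (sigma_plus (bM (m - 1))) (fps_const (vac (m - 1 - 1)))) =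
    fps_act (\<diamondop>) (sigma_plus (bM m)) (fps_const (vac (m - 1)))"
proof -
  let ?act = "fps_act (\<diamondop>)" and ?s = "sigma_plus (bM m)" and ?b = "fps_const (bM (m - 1))"
  have s: "sigma_plus (bM (m - 1)) = ?b + fps_X * ?s"
  proof (rule fps_ext)
    fix n
    show "fps_nth (sigma_plus (bM (m - 1))) n = fps_nth (?b + fps_X * ?s) n"
      by (cases n) (simp_all add: sigma_plus_bM)
  qed
  have "?s * ?s = sigma_plus (bM m * bM m)"
    using HS_sigma_plus(1) by (simp add: HS_derivation_def)
  also have "\<dots> = 0"
    using HS_derivation_0[OF HS_sigma_plus(1)] by (simp add: bM_square)
  finally have "?s * (fps_X * ?s) = 0"
    by (metis fps_mult_fps_X_commute mult.assoc mult_zero_right)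
  then have "?s * sigma_plus (bM (m - 1)) = ?s * ?b"
    by (simp add: s distrib_left)
  moreover have "?act ?b (fps_const (vac (m - 1 - 1))) = fps_const (vac (m - 1))"
    using bM_wedge_vac[of "m - 1"] by (auto intro!: fps_ext simp: wedge_series_const)
  ultimately show ?thesis
    by (metis wedge_series_assoc)
qed

text \<open>In positive degree the vector \<open>b_{m-i}\<close> already occurs in the vacuum
  \<open>[b]_{m-1}\<close>.\<close>

lemma sigma_minus_F_compatible:
  "fps_act (\<diamondop>) (sigma_minus (bM m)) (fps_const (vac (m - 1))) = fps_const (vac m)"
  using bM_wedge_vac[of m]
  by (auto intro!: fps_ext bM_wedge_vac_eq_0 simp: wedge_series_const sigma_minus_bM)

lemma sigma_bar_minus_F_compatible:
  "fps_act (\<diamondop>) (sigma_bar_minus (bM m)) (fps_const (vac (m - 1))) = fps_const (vac m)"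
  using bM_wedge_vac[of m]
  by (auto intro!: fps_ext bM_wedge_vac_eq_0 simp: wedge_series_binomial sigma_bar_minus_bM)

lemma int_scale_sign:
  "int_scale ((- 1) ^ n) x = (if even n then x else - x)"
  "int_scale 1 x = x" "int_scale (- 1) x = - x"
  by (simp_all add: int_scale_def)

text \<open>Removing the top row of a column lowers the charge by one.\<close>

lemma vac_part_column_Suc:
  "vac_part m (replicate (Suc j) 1) = bM (m + 1) \<diamondop> vac_part (m - 1) (replicate j 1)"
proof -
  have "b_row (Suc j) m (replicate (Suc j) 1) = bM (m + 1) * b_row j (m - 1) (replicate j 1)"
    unfolding b_row_def map_upt_Suc
    by (auto simp: part_def nth_Cons algebra_simps intro!: arg_cong[where f = prod_list]
        arg_cong2[where f = "(*)"])
  then show ?thesis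
    by (simp add: vac_part_def wedge_wedge algebra_simps del: replicate_Suc)
qed

lemma vac_part_Nil: "vac_part m [] = vac m"
  by (simp add: vac_part_def b_row_def)

text \<open>A nonempty column of charge \<open>m - 1\<close> starts with \<open>b_m\<close>.\<close>

lemma bM_wedge_column:
  "bM m \<diamondop> vac_part (m - 1) (replicate j 1) = (if j = 0 then vac m else 0)"
proof (cases j)
  case 0
  then show ?thesis by (simp add: vac_part_Nil bM_wedge_vac)
next
  case (Suc k)
  have "bM m \<diamondop> vac_part (m - 1) (replicate (Suc k) 1) = 0"
    unfolding vac_part_column_Suc by (simp add: wedge_wedge bM_square)
  then show ?thesis using Suc by simp
qed

text \<open>The term \<open>b_m\<close> contributes only in degree zero, by
  \<open>bM_wedge_column\<close>. The term with \<open>- b_{m+1}\<close> adds a box to the column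
  and supplies the sign.\<close>

lemma sigma_bar_plus_F_compatible:
  "fps_act (\<diamondop>) (sigma_bar_plus (bM m))
      (Abs_fps (\<lambda>j. int_scale ((- 1) ^ j) (vac_part (m - 1) (replicate j 1)))) =
    Abs_fps (\<lambda>j. int_scale ((- 1) ^ j) (vac_part m (replicate j 1)))"
proof (rule fps_ext)
  fix n
  show "fps_nth (fps_act (\<diamondop>) (sigma_bar_plus (bM m))
      (Abs_fps (\<lambda>j. int_scale ((- 1) ^ j) (vac_part (m - 1) (replicate j 1))))) n =
    fps_nth (Abs_fps (\<lambda>j. int_scale ((- 1) ^ j) (vac_part m (replicate j 1)))) n"
  proof (cases n)
    case 0
    then show ?thesis
      using bM_wedge_column[of m 0]
      by (simp add: sigma_bar_plus_bM wedge_series_binomial int_scale_sign vac_part_Nil)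
  next
    case (Suc k)
    then show ?thesis
      using bM_wedge_column[of m n] vac_part_column_Suc[of m k]
      by (simp add: sigma_bar_plus_bM wedge_series_binomial int_scale_sign del: replicate_Suc)
  qed
qed

lemmas sigma_plus_F_simps =
  fock_extension_wedge[OF HS_sigma_plus sigma_plus_F_compatible, folded sigma_plus_F_def]
  fock_extension_vac[OF HS_sigma_plus sigma_plus_F_compatible, folded sigma_plus_F_def]
lemmas additive_sigma_plus_F =
  additive_fock_extension[OF HS_sigma_plus sigma_plus_F_compatible, folded sigma_plus_F_def]

lemmas sigma_minus_F_simps =
  fock_extension_wedge[OF HS_sigma_minus sigma_minus_F_compatible, folded sigma_minus_F_def]
  fock_extension_vac[OF HS_sigma_minus sigma_minus_F_compatible, folded sigma_minus_F_def]
lemmas additive_sigma_minus_F =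
  additive_fock_extension[OF HS_sigma_minus sigma_minus_F_compatible, folded sigma_minus_F_def]

lemmas sigma_bar_plus_F_simps =
  fock_extension_wedge[OF HS_sigma_bar_plus sigma_bar_plus_F_compatible, folded sigma_bar_plus_F_def]
  fock_extension_vac[OF HS_sigma_bar_plus sigma_bar_plus_F_compatible, folded sigma_bar_plus_F_def]
lemmas additive_sigma_bar_plus_F =
  additive_fock_extension[OF HS_sigma_bar_plus sigma_bar_plus_F_compatible, folded sigma_bar_plus_F_def]

lemmas sigma_bar_minus_F_simps =
  fock_extension_wedge[OF HS_sigma_bar_minus sigma_bar_minus_F_compatible, folded sigma_bar_minus_F_def]
  fock_extension_vac[OF HS_sigma_bar_minus sigma_bar_minus_F_compatible, folded sigma_bar_minus_F_def]
lemmas additive_sigma_bar_minus_F =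
  additive_fock_extension[OF HS_sigma_bar_minus sigma_bar_minus_F_compatible, folded sigma_bar_minus_F_def]

section \<open>Commutation of series of operators\<close>

abbreviation wedge2 :: "ext fps fps \<Rightarrow> fock fps fps \<Rightarrow> fock fps fps"
  where "wedge2 \<equiv> fps_act (fps_act (\<diamondop>))"

lemma wedge2_nth:
  "fps_nth (fps_nth (wedge2 A Y) i) j =
    (\<Sum>k=0..i. \<Sum>l=0..j. fps_nth (fps_nth A k) l \<diamondop> fps_nth (fps_nth Y (i - k)) (j - l))"
  by (simp add: fps_nth_fps_act fps_sum_nth)

lemma wedge2_add: "wedge2 A (Y + Z) = wedge2 A Y + wedge2 A Z"
  by (intro additive.add additive_fps_act_right additive_wedge_right)

lemma fps_map_nth [simp]: "fps_nth (fps_map T f) n = T (fps_nth f n)"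
  by (simp add: fps_map_def)

lemma fps_swap_nth [simp]: "fps_nth (fps_nth (fps_swap f) i) j = fps_nth (fps_nth f j) i"
  by (simp add: fps_swap_def)

lemma fps_map_wedge:
  assumes T: "additive T" "\<And>u x. T (u \<diamondop> x) = fps_act (\<diamondop>) (D u) (T x)"
  shows "fps_map T (fps_act (\<diamondop>) g h) = wedge2 (fps_map D g) (fps_map T h)"
  by (rule fps_ext) (simp add: fps_nth_fps_act additive.sum[OF T(1)] T(2))

lemma fps_swap_wedge2: "fps_swap (wedge2 A Y) = wedge2 (fps_swap A) (fps_swap Y)"
  by (intro fps_ext) (simp only: fps_swap_nth wedge2_nth, rule sum.swap)

text \<open>Multiplication by \<open>p q\<inverse>\<close>.\<close>

definition diag_shift :: "fock fps fps \<Rightarrow> fock fps fps"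
  where "diag_shift Y = Abs_fps (\<lambda>i. Abs_fps (\<lambda>j.
    if i = 0 \<or> j = 0 then 0 else fps_nth (fps_nth Y (i - 1)) (j - 1)))"

lemma diag_shift_nth:
  "fps_nth (fps_nth (diag_shift Y) i) j =
    (if i = 0 \<or> j = 0 then 0 else fps_nth (fps_nth Y (i - 1)) (j - 1))"
  by (simp add: diag_shift_def)

lemma additive_diag_shift: "additive diag_shift"
  by standard (auto intro!: fps_ext simp: diag_shift_nth)

lemma diag_shift_wedge2: "diag_shift (wedge2 A Y) = wedge2 A (diag_shift Y)"
proof (intro fps_ext)
  fix i j
  let ?a = "\<lambda>k l. fps_nth (fps_nth A k) l" and ?y = "\<lambda>k l. fps_nth (fps_nth Y k) l"
  show "fps_nth (fps_nth (diag_shift (wedge2 A Y)) i) j = fps_nth (fps_nth (wedge2 A (diag_shift Y)) i) j"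
  proof (cases "i = 0 \<or> j = 0")
    case True
    then show ?thesis
      by (auto simp: diag_shift_nth wedge2_nth)
  next
    case False
    then obtain i' j' where ij: "i = Suc i'" "j = Suc j'"
      by (metis not0_implies_Suc)
    \<comment> \<open>The top terms \<open>k = i\<close> or \<open>l = j\<close> meet the zero
      border of \<open>diag_shift Y\<close>.\<close>
    have "fps_nth (fps_nth (wedge2 A (diag_shift Y)) i) j =
        (\<Sum>k=0..i'. \<Sum>l=0..j'. ?a k l \<diamondop> fps_nth (fps_nth (diag_shift Y) (Suc i' - k)) (Suc j' - l))"
      by (simp add: ij wedge2_nth sum.atLeast0_atMost_Suc diag_shift_nth)
    also have "\<dots> = (\<Sum>k=0..i'. \<Sum>l=0..j'. ?a k l \<diamondop> ?y (i' - k) (j' - l))"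
      by (intro sum.cong) (auto simp: diag_shift_nth)
    also have "\<dots> = fps_nth (fps_nth (diag_shift (wedge2 A Y)) i) j"
      by (simp add: ij diag_shift_nth wedge2_nth)
    finally show ?thesis by (rule sym)
  qed
qed

lemma series_scale_geometric_nth:
  "fps_nth (fps_nth (series_scale geometric_expansion Y) i) j =
    (\<Sum>k=0..i. if k \<le> j then fps_nth (fps_nth Y (i - k)) (j - k) else 0)"
proof -
  have "(\<Sum>l=0..j. int_scale (if k = l then 1 else 0) (fps_nth (fps_nth Y (i - k)) (j - l))) =
      (if k \<le> j then fps_nth (fps_nth Y (i - k)) (j - k) else 0)" for k
  proof -
    have "(\<Sum>l=0..j. int_scale (if k = l then 1 else 0) (fps_nth (fps_nth Y (i - k)) (j - l))) =
        (\<Sum>l=0..j. if k = l then fps_nth (fps_nth Y (i - k)) (j - l) else 0)"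
      by (rule sum.cong) (simp_all add: int_scale_def)
    then show ?thesis by simp
  qed
  then show ?thesis
    by (simp add: series_scale_def geometric_expansion_def fps_nth_fps_act fps_sum_nth)
qed

text \<open>Unrolling the equation descends a diagonal until one exponent reaches zero, collecting
  the terms of the geometric series.\<close>

lemma series_scale_geometricI:
  assumes X: "X = Y + diag_shift X"
  shows "X = series_scale geometric_expansion Y"
proof (intro fps_ext)
  fix i j
  have rec: "fps_nth (fps_nth X i) j =
      fps_nth (fps_nth Y i) j + (if i = 0 \<or> j = 0 then 0 else fps_nth (fps_nth X (i - 1)) (j - 1))" for i j
    using arg_cong[OF X, of "\<lambda>X. fps_nth (fps_nth X i) j"] by (simp add: diag_shift_nth)
  have "fps_nth (fps_nth X i) j = (\<Sum>k=0..i. if k \<le> j then fps_nth (fps_nth Y (i - k)) (j - k) else 0)"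
  proof (induction i arbitrary: j)
    case 0
    show ?case using rec[of 0 j] by simp
  next
    case (Suc i)
    show ?case
    proof (cases j)
      case 0
      then show ?thesis using rec[of "Suc i" 0] by (simp add: sum.atLeast0_atMost_Suc_shift)
    next
      case j: (Suc j')
      show ?thesis
        unfolding j using rec[of "Suc i" "Suc j'"] Suc.IH[of j']
        by (simp add: sum.atLeast0_atMost_Suc_shift comp_def del: sum.cl_ivl_Suc cong: if_cong)
    qed
  qed
  then show "fps_nth (fps_nth X i) j = fps_nth (fps_nth (series_scale geometric_expansion Y) i) j"
    by (simp add: series_scale_geometric_nth)
qed

text \<open>In the form \<open>L = R + diag_shift L\<close> the rule is stable under sums, negation
  and wedging, so \<open>fock_induct\<close> applies.\<close>

lemma commutation_from_vac:
  assumes T: "additive T" "\<And>u x. T (u \<diamondop> x) = fps_act (\<diamondop>) (D u) (T x)"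
    and U: "additive U" "\<And>u x. U (u \<diamondop> x) = fps_act (\<diamondop>) (E u) (U x)"
    and comm: "\<And>j. fps_map D (E (bM j)) = fps_swap (fps_map E (D (bM j)))"
    and vac: "\<And>m. fps_map T (U (vac m)) =
      fps_swap (fps_map U (T (vac m))) + diag_shift (fps_map T (U (vac m)))"
  shows "fps_map T (U x) = series_scale geometric_expansion (fps_swap (fps_map U (T x)))"
proof (rule series_scale_geometricI)
  have L_add: "additive (\<lambda>x. fps_map T (U x))"
    by standard (auto intro!: fps_ext simp: additive.add[OF T(1)] additive.add[OF U(1)])
  have R_add: "additive (\<lambda>x. fps_swap (fps_map U (T x)))"
    by standard (auto intro!: fps_ext simp: additive.add[OF T(1)] additive.add[OF U(1)])
  show "fps_map T (U x) = fps_swap (fps_map U (T x)) + diag_shift (fps_map T (U x))"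
  proof (induction x rule: fock_induct)
    case (vac m)
    show ?case by (rule assms)
  next
    case (wedge j x)
    let ?B = "fps_map D (E (bM j))"
    have L: "fps_map T (U (bM j \<diamondop> x)) = wedge2 ?B (fps_map T (U x))"
      by (simp only: U(2) fps_map_wedge[OF T])
    \<comment> \<open>By \<open>comm\<close> the swapped series acting here is the same
      \<open>?B\<close> as on the left.\<close>
    have R: "fps_swap (fps_map U (T (bM j \<diamondop> x))) = wedge2 ?B (fps_swap (fps_map U (T x)))"
      using comm[of j] by (simp only: T(2) fps_map_wedge[OF U] fps_swap_wedge2)
    show ?case
      unfolding L R diag_shift_wedge2 wedge2_add[symmetric] using wedge.IH by simp
  next
    case (add x y)
    show ?case
      unfolding additive.add[OF L_add] additive.add[OF R_add] additive.add[OF additive_diag_shift]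
      using arg_cong2[OF add, of "(+)"] by (simp only: ac_simps)
  next
    case (uminus x)
    show ?case
      unfolding additive.minus[OF L_add] additive.minus[OF R_add] additive.minus[OF additive_diag_shift]
      using arg_cong[OF uminus, of uminus] by (simp only: minus_add_distrib)
  qed
qed

lemma fps_swap_fps_map_const:
  assumes "additive U"
  shows "fps_nth (fps_nth (fps_swap (fps_map U (fps_const x))) i) j =
    (if j = 0 then fps_nth (U x) i else 0)"
  by (simp add: additive.zero[OF assms])

section \<open>The commutation rules on the vacua\<close>

text \<open>The left coefficient at \<open>i\<close>, \<open>j\<close> depends only on
  \<open>i - j\<close>, so subtracting the diagonal shift leaves the border. There
  \<open>j = 0\<close> gives the right side, and \<open>i = 0 < j\<close> gives zero because the
  vacuum contains \<open>b_{m-j}\<close>.\<close>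

lemma sigma_commute_vac:
  "fps_map sigma_minus_F (sigma_plus_F (vac m)) =
    fps_swap (fps_map sigma_plus_F (sigma_minus_F (vac m))) +
    diag_shift (fps_map sigma_minus_F (sigma_plus_F (vac m)))"
proof -
  have plus: "fps_nth (sigma_plus_F (vac m)) i = bM (m + int i) \<diamondop> vac (m - 1)" for i
    by (simp add: sigma_plus_F_simps wedge_series_const sigma_plus_bM)
  have L: "fps_nth (fps_nth (fps_map sigma_minus_F (sigma_plus_F (vac m))) i) j =
      bM (m + int i - int j) \<diamondop> vac (m - 1)" for i j
    by (simp add: plus sigma_minus_F_simps wedge_series_const sigma_minus_bM)
  show ?thesis
  proof (intro fps_ext)
    fix i j
    show "fps_nth (fps_nth (fps_map sigma_minus_F (sigma_plus_F (vac m))) i) j =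
      fps_nth (fps_nth (fps_swap (fps_map sigma_plus_F (sigma_minus_F (vac m))) +
        diag_shift (fps_map sigma_minus_F (sigma_plus_F (vac m)))) i) j"
      unfolding fps_add_nth diag_shift_nth L sigma_minus_F_simps
        fps_swap_fps_map_const[OF additive_sigma_plus_F] plus
      by (cases i; cases j) (simp_all add: bM_wedge_vac_eq_0 add_diff_eq)
  qed
qed

text \<open>Peel off the top row, whose series is \<open>b_{m+1}\<close> minus \<open>b_m\<close>
  times the variable. Wedging \<open>b_m\<close> onto the remaining column gives zero unless that
  column is empty.\<close>

lemma sigma_bar_minus_F_column:
  "fps_nth (sigma_bar_minus_F (vac_part m (replicate i 1))) j =
    (if j \<le> i then int_scale ((- 1) ^ j) (vac_part m (replicate (i - j) 1)) else 0)"
proof (induction i arbitrary: m j)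
  case 0
  show ?case by (simp add: vac_part_Nil sigma_bar_minus_F_simps int_scale_def)
next
  case (Suc i)
  have *: "fps_nth (sigma_bar_minus_F (vac_part m (replicate (Suc i) 1))) j =
      bM (m + 1) \<diamondop> fps_nth (sigma_bar_minus_F (vac_part (m - 1) (replicate i 1))) j -
      (if j = 0 then 0 else bM m \<diamondop> fps_nth (sigma_bar_minus_F (vac_part (m - 1) (replicate i 1))) (j - 1))"
    unfolding vac_part_column_Suc sigma_bar_minus_F_simps sigma_bar_minus_bM wedge_series_binomial by simp
  show ?case
  proof (cases j)
    case 0
    then show ?thesis
      unfolding * Suc.IH using vac_part_column_Suc[of m i]
      by (simp add: int_scale_sign del: replicate_Suc)
  next
    case j: (Suc k)
    consider "k < i" | "k = i" | "k > i" by linarith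
    then show ?thesis
    proof cases
      case 1
      then have "Suc i - j = Suc (i - j)" "j \<le> i" using j by auto
      then show ?thesis
        unfolding * Suc.IH using 1 j vac_part_column_Suc[of m "i - j"] bM_wedge_column[of m "i - k"]
        by (simp add: int_scale_sign del: replicate_Suc)
    next
      \<comment> \<open>Here \<open>j = i + 1\<close>: the first term vanishes, and
        \<open>b_m\<close> is absorbed by the vacuum left after the column is used up.\<close>
      case 2
      then show ?thesis
        unfolding * Suc.IH using j bM_wedge_column[of m 0]
        by (simp add: int_scale_sign vac_part_Nil)
    next
      case 3
      then show ?thesis
        unfolding * Suc.IH using j by simp
    qed
  qed
qed

text \<open>Again the left coefficients are constant along diagonals, since \<open>i + j\<close> and
  \<open>i - j\<close> have the same parity, and they vanish for \<open>j > i\<close>.\<close>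

lemma sigma_bar_commute_vac:
  "fps_map sigma_bar_minus_F (sigma_bar_plus_F (vac m)) =
    fps_swap (fps_map sigma_bar_plus_F (sigma_bar_minus_F (vac m))) +
    diag_shift (fps_map sigma_bar_minus_F (sigma_bar_plus_F (vac m)))"
proof -
  have plus: "fps_nth (sigma_bar_plus_F (vac m)) i =
      int_scale ((- 1) ^ i) (vac_part m (replicate i 1))" for i
    by (simp add: sigma_bar_plus_F_simps)
  have L: "fps_nth (fps_nth (fps_map sigma_bar_minus_F (sigma_bar_plus_F (vac m))) i) j =
      (if j \<le> i then int_scale ((- 1) ^ (i + j)) (vac_part m (replicate (i - j) 1)) else 0)" for i j
    unfolding fps_map_nth plus
    by (simp add: int_scale_sign additive.minus[OF additive_sigma_bar_minus_F] sigma_bar_minus_F_column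
        del: One_nat_def)
  show ?thesis
  proof (intro fps_ext)
    fix i j
    show "fps_nth (fps_nth (fps_map sigma_bar_minus_F (sigma_bar_plus_F (vac m))) i) j =
      fps_nth (fps_nth (fps_swap (fps_map sigma_bar_plus_F (sigma_bar_minus_F (vac m))) +
        diag_shift (fps_map sigma_bar_minus_F (sigma_bar_plus_F (vac m)))) i) j"
      unfolding fps_add_nth diag_shift_nth L sigma_bar_minus_F_simps
        fps_swap_fps_map_const[OF additive_sigma_bar_plus_F] plus
      by (cases i; cases j) (simp_all add: int_scale_sign del: replicate_Suc)
  qed
qed

lemma sigma_commute_bM:
  "fps_map sigma_minus (sigma_plus (bM j)) = fps_swap (fps_map sigma_plus (sigma_minus (bM j)))"
  by (intro fps_ext) (simp add: sigma_plus_bM sigma_minus_bM algebra_simps)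

lemma sigma_bar_commute_bM:
  "fps_map sigma_bar_minus (sigma_bar_plus (bM j)) =
    fps_swap (fps_map sigma_bar_plus (sigma_bar_minus (bM j)))"
proof (intro fps_ext)
  have add: "additive sigma_bar_plus" "additive sigma_bar_minus"
    using HS_sigma_bar_plus(1) HS_sigma_bar_minus(1) by (simp_all add: HS_derivation_def)
  fix i k
  show "fps_nth (fps_nth (fps_map sigma_bar_minus (sigma_bar_plus (bM j))) i) k =
    fps_nth (fps_nth (fps_swap (fps_map sigma_bar_plus (sigma_bar_minus (bM j)))) i) k"
    by (simp add: sigma_bar_plus_bM sigma_bar_minus_bM fps_X_nth additive.zero[OF add(1)]
        additive.zero[OF add(2)] additive.diff[OF add(1)] additive.diff[OF add(2)]
        additive.minus[OF add(1)] additive.minus[OF add(2)] mult_delta_right)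
qed

theorem proposition8p4:
  shows "(\<forall>x. fps_map sigma_minus_F (sigma_plus_F x) =
        series_scale geometric_expansion (fps_swap (fps_map sigma_plus_F (sigma_minus_F x)))) \<and>
    (\<forall>x. fps_map sigma_bar_minus_F (sigma_bar_plus_F x) =
        series_scale geometric_expansion (fps_swap (fps_map sigma_bar_plus_F (sigma_bar_minus_F x))))"
  using commutation_from_vac[OF additive_sigma_minus_F sigma_minus_F_simps(1)
      additive_sigma_plus_F sigma_plus_F_simps(1) sigma_commute_bM sigma_commute_vac]
    commutation_from_vac[OF additive_sigma_bar_minus_F sigma_bar_minus_F_simps(1)
      additive_sigma_bar_plus_F sigma_bar_plus_F_simps(1) sigma_bar_commute_bM sigma_bar_commute_vac]
  by blast

end
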